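(* Let $E$ be a real Banach space, $H$ a real Hilbert space, $A$ the generator of a $C_0$-semigroup $(S(t))_{t\ge 0}$ on $E$, and $B\colon H\to E$ a nonzero bounded linear operator. Assume that for every $t\in(0,\infty)$ there is a centered Gaussian Radon measure $\mu_t$ on $E$ with covariance operator $Q_t\in\mathcal{L}(E^*,E)$ given by $\langle Q_t x^*,y^*\rangle=\int_0^t\langle S(s)BB^*S^*(s)x^*,y^*\rangle\,ds$ for $x^*,y^*\in E^*$; that the limit $Q_\infty=\lim_{t\to\infty}Q_t$ exists in the weak operator topology of $\mathcal{L}(E^*,E)$; and that there is a centered Gaussian Radon measure $\mu_\infty$ on $E$ with covariance operator $Q_\infty$, which is nondegenerate. If the point spectrum of $A^*$ is nonempty, $\sigma_p(A^* )\neq\varnothing$, then the Ornstein--Uhlenbeck semigroup $(P(t))_{t\ge0}$ on $L^1(E,\mu_\infty)$ is norm discontinuous everywhere, i.e. the map $t\mapsto P(t)$ from $[0,\infty)$ to $\mathcal{L}(L^1(E,\mu_\infty))$ with the operator norm is discontinuous at every $t\ge 0$.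
   Context: The Ornstein--Uhlenbeck semigroup is defined on bounded Borel functions $f$ on $E$ by $(P(t)f)(x)=\int_E f(S(t)x+y)\,d\mu_t(y)$ for $t>0$, $x\in E$, and $P(0)f=f$. It is the transition semigroup of the stochastic Cauchy problem $dU_t=AU_t\,dt+B\,dW^H_t$, $U_0=x$, where $(W^H_t)_{t\ge 0}$ is an $H$-cylindrical Wiener process. Under the assumptions in the claim, $\mu_\infty$ is invariant, i.e. $\int_E P(t)f\,d\mu_\infty=\int_E f\,d\mu_\infty$ for all $t\ge0$, and $(P(t))_{t\ge0}$ extends uniquely to a strongly continuous contraction semigroup on $L^1(E,\mu_\infty)$, also denoted $(P(t))_{t\ge0}$. Here $H$ is identified with its dual, so that $B^*\colon E^*\to H$ and $BB^*\in\mathcal{L}(E^*,E)$; $S^*(s)$ is the adjoint of $S(s)$ and $A^*$ the adjoint of $A$. A centered Gaussian Radon measure $\mu$ has covariance operator $R\in\mathcal{L}(E^*,E)$ if $\langle Rx^*,y^*\rangle=\int_E\langle x,x^*\rangle\langle x,y^*\rangle\,d\mu(x)$ for all $x^*,y^*\in E^*$. Nondegeneracy of $\mu_\infty$ means $\langle Q_\infty x^*,x^*\rangle>0$ for all nonzero $x^*\in E^*$. The point spectrum of $A^*$ is understood over $\mathbb{C}$, i.e. as that of its complexification on the complexification $E^*_{\mathbb{C}}$ of $E^*$, and $L^1(E,\mu_\infty)$ is the complex space of complex-valued functions. *)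

theory Defs
  imports "HOL-Probability.Probability"
begin

definition c0_semigroup :: "(real \<Rightarrow> ('e::banach \<Rightarrow>\<^sub>L 'e)) \<Rightarrow> bool" where
  "c0_semigroup S \<longleftrightarrow>
     S 0 = id_blinfun \<and>
     (\<forall>s\<ge>0. \<forall>t\<ge>0. S (s + t) = S s o\<^sub>L S t) \<and>
     (\<forall>x. ((\<lambda>t. S t x) \<longlongrightarrow> x) (at_right 0))"

text \<open>Unbounded operators are represented by their graphs.\<close>

definition generator :: "(real \<Rightarrow> ('e::banach \<Rightarrow>\<^sub>L 'e)) \<Rightarrow> ('e \<times> 'e) set" where
  "generator S = {(x, y). ((\<lambda>t. (S t x - x) /\<^sub>R t) \<longlongrightarrow> y) (at_right 0)}"

definition adjoint_op :: "('e::real_normed_vector \<times> 'e) set \<Rightarrow> (('e \<Rightarrow>\<^sub>L real) \<times> ('e \<Rightarrow>\<^sub>L real)) set" where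
  "adjoint_op A = {(u, v). \<forall>(x, y)\<in>A. blinfun_apply u y = blinfun_apply v x}"

text \<open>The complexification of a real vector space is the set of pairs \<open>(u, v)\<close>, read as
  \<open>u + i v\<close>; a real operator acts on it componentwise.\<close>

definition cscale :: "complex \<Rightarrow> 'v::real_vector \<times> 'v \<Rightarrow> 'v \<times> 'v" where
  "cscale c z = (Re c *\<^sub>R fst z - Im c *\<^sub>R snd z, Im c *\<^sub>R fst z + Re c *\<^sub>R snd z)"

definition complexify_op :: "('v \<times> 'v) set \<Rightarrow> (('v \<times> 'v) \<times> ('v \<times> 'v)) set" where
  "complexify_op G = {((u1, u2), (v1, v2)). (u1, v1) \<in> G \<and> (u2, v2) \<in> G}"

definition point_spectrum :: "('v::real_vector \<times> 'v) set \<Rightarrow> complex set" where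
  "point_spectrum G = {c. \<exists>z. z \<noteq> 0 \<and> (z, cscale c z) \<in> complexify_op G}"

text \<open>The adjoint \<open>E\<^sup>* \<rightarrow> H\<close> of \<open>B : H \<rightarrow> E\<close>, with \<open>H\<close> identified with its dual: the unique
  vector given by the Riesz representation theorem.\<close>

definition hilbert_adjoint ::
  "('h::{real_inner,complete_space} \<Rightarrow>\<^sub>L 'e::banach) \<Rightarrow> ('e \<Rightarrow>\<^sub>L real) \<Rightarrow> 'h" where
  "hilbert_adjoint B u = (THE h. \<forall>g. inner h g = u (B g))"

definition centered_normal_law :: "real measure \<Rightarrow> bool" where
  "centered_normal_law N \<longleftrightarrow>
     N = return borel 0 \<or> (\<exists>\<sigma>>0. N = density lborel (\<lambda>x. ennreal (normal_density 0 \<sigma> x)))"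

definition centered_gaussian_radon :: "'e::banach measure \<Rightarrow> bool" where
  "centered_gaussian_radon M \<longleftrightarrow>
     prob_space M \<and> sets M = sets borel \<and>
     (\<forall>A\<in>sets borel. emeasure M A = (SUP K\<in>{K. compact K \<and> K \<subseteq> A}. emeasure M K)) \<and>
     (\<forall>u :: 'e \<Rightarrow>\<^sub>L real. centered_normal_law (distr M borel (blinfun_apply u)))"

definition has_covariance :: "'e::banach measure \<Rightarrow> (('e \<Rightarrow>\<^sub>L real) \<Rightarrow>\<^sub>L 'e) \<Rightarrow> bool" where
  "has_covariance M R \<longleftrightarrow>
     (\<forall>u v :: 'e \<Rightarrow>\<^sub>L real. v (R u) = (\<integral>x. u x * v x \<partial>M))"

text \<open>Elements of \<open>L\<^sup>1(M)\<close> are represented by \<open>M\<close>-integrable functions, equality being equality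
  \<open>M\<close>-almost everywhere. Operators act on representatives; a linear operator that is bounded
  for the \<open>L\<^sup>1\<close> seminorm respects equality almost everywhere.\<close>

definition L1_norm :: "'a measure \<Rightarrow> ('a \<Rightarrow> complex) \<Rightarrow> real" where
  "L1_norm M f = (\<integral>x. norm (f x) \<partial>M)"

definition L1_linear :: "'a measure \<Rightarrow> (('a \<Rightarrow> complex) \<Rightarrow> ('a \<Rightarrow> complex)) \<Rightarrow> bool" where
  "L1_linear M T \<longleftrightarrow>
     (\<forall>f. integrable M f \<longrightarrow> integrable M (T f)) \<and>
     (\<forall>f g. integrable M f \<longrightarrow> integrable M g \<longrightarrow>
        (AE x in M. T (\<lambda>y. f y + g y) x = T f x + T g x)) \<and>
     (\<forall>c f. integrable M f \<longrightarrow> (AE x in M. T (\<lambda>y. c * f y) x = c * T f x))"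

text \<open>The operator norm on the bounded operators of \<open>L\<^sup>1(M)\<close>; the supremum is that of a bounded set whenever \<open>T\<close> is
  bounded.\<close>

definition L1_opnorm :: "'a measure \<Rightarrow> (('a \<Rightarrow> complex) \<Rightarrow> ('a \<Rightarrow> complex)) \<Rightarrow> real" where
  "L1_opnorm M T = (SUP f\<in>{f. integrable M f \<and> L1_norm M f \<le> 1}. L1_norm M (T f))"

definition L1_contraction_semigroup ::
  "'a measure \<Rightarrow> (real \<Rightarrow> ('a \<Rightarrow> complex) \<Rightarrow> ('a \<Rightarrow> complex)) \<Rightarrow> bool" where
  "L1_contraction_semigroup M T \<longleftrightarrow>
     (\<forall>t\<ge>0. L1_linear M (T t) \<and> (\<forall>f. integrable M f \<longrightarrow> L1_norm M (T t f) \<le> L1_norm M f)) \<and>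
     (\<forall>f. integrable M f \<longrightarrow> (AE x in M. T 0 f x = f x)) \<and>
     (\<forall>s\<ge>0. \<forall>t\<ge>0. \<forall>f. integrable M f \<longrightarrow> (AE x in M. T (s + t) f x = T s (T t f) x)) \<and>
     (\<forall>f. integrable M f \<longrightarrow> ((\<lambda>t. L1_norm M (\<lambda>x. T t f x - f x)) \<longlongrightarrow> 0) (at_right 0))"

definition ou_operator ::
  "(real \<Rightarrow> ('e::banach \<Rightarrow>\<^sub>L 'e)) \<Rightarrow> (real \<Rightarrow> 'e measure) \<Rightarrow> real \<Rightarrow> ('e \<Rightarrow> complex) \<Rightarrow> 'e \<Rightarrow> complex" where
  "ou_operator S \<mu> t f x = (if t = 0 then f x else (\<integral>y. f (S t x + y) \<partial>\<mu> t))"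

definition ou_extension ::
  "(real \<Rightarrow> ('e::banach \<Rightarrow>\<^sub>L 'e)) \<Rightarrow> (real \<Rightarrow> 'e measure) \<Rightarrow> 'e measure \<Rightarrow>
   (real \<Rightarrow> ('e \<Rightarrow> complex) \<Rightarrow> ('e \<Rightarrow> complex)) \<Rightarrow> bool" where
  "ou_extension S \<mu> M T \<longleftrightarrow>
     L1_contraction_semigroup M T \<and>
     (\<forall>t\<ge>0. \<forall>f. f \<in> borel_measurable borel \<longrightarrow> bounded (range f) \<longrightarrow>
        (AE x in M. T t f x = ou_operator S \<mu> t f x))"

text \<open>Bounded Borel functions are dense in \<open>L\<^sup>1(M)\<close>, so for \<open>t \<ge> 0\<close> and integrable \<open>f\<close> the
  function \<open>ou_semigroup S \<mu> M t f\<close> is determined almost everywhere: choosing an extension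
  amounts only to choosing representatives.\<close>

definition ou_semigroup ::
  "(real \<Rightarrow> ('e::banach \<Rightarrow>\<^sub>L 'e)) \<Rightarrow> (real \<Rightarrow> 'e measure) \<Rightarrow> 'e measure \<Rightarrow>
   real \<Rightarrow> ('e \<Rightarrow> complex) \<Rightarrow> ('e \<Rightarrow> complex)" where
  "ou_semigroup S \<mu> M = (SOME T. ou_extension S \<mu> M T)"

end

theory Submission
  imports Defs
begin

text \<open>
  Write \<open>q u\<close> for the variance \<open>\<langle>Q\<^sub>\<infinity> u, u\<rangle>\<close> of a functional \<open>u\<close> under the invariant measure. The
  argument rests on the densities \<open>exp (u x - q u / 2)\<close> of Cameron and Martin: they have integral one,
  and because \<open>Q\<^sub>\<infinity> = Q\<^sub>t + S(t) Q\<^sub>\<infinity> S(t)\<^sup>*\<close> the operator \<open>P(t)\<close> carries the density of \<open>u\<close> to the density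
  of \<open>u \<circ> S(t)\<close>. The densities of \<open>u\<close> and \<open>v\<close> belong to translates of one Gaussian measure, and
  comparing total variation with the Hellinger integral puts them at \<open>L\<^sup>1\<close> distance at least
  \<open>2 - 2 exp (- q (u - v) / 8)\<close>. If \<open>w \<circ> S(s) \<noteq> w \<circ> S(t)\<close> for some \<open>w\<close>, then nondegeneracy and multiples
  of \<open>w\<close> push this distance towards 2, so \<open>P(s) - P(t)\<close> has norm at least 1
  (\<open>L1_opnorm_diff_ge_1\<close>).

  It remains to see that an eigenvalue of \<open>A\<^sup>*\<close> keeps all the adjoints \<open>S(t)\<^sup>*\<close> apart
  (\<open>adjoint_orbits_distinct\<close>). If \<open>S(s)\<^sup>* = S(t)\<^sup>*\<close> with \<open>s < t\<close>, then the adjoint orbits are periodic from \<open>s\<close> on; but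
  the variance of \<open>u \<circ> S(r)\<close> is the tail \<open>q u - \<langle>Q\<^sub>r u, u\<rangle>\<close>, which tends to zero, so \<open>S(s)\<^sup>*\<close>
  vanishes. This contradicts the existence of an eigenvector, which \<open>S(s)\<^sup>*\<close> multiplies by
  the nonzero number \<open>exp (\<lambda> s)\<close>.

  Since the semigroup is chosen as some strongly continuous contraction semigroup that extends the
  Mehler formula, such an extension has to be constructed as well
  (\<open>ou_extension_ou_operator\<close>). Mehler's formula is integration against the translated measures
  \<open>S(t) x + \<mu>\<^sub>t\<close>. Invariance of \<open>\<mu>\<^sub>\<infinity>\<close> and the Chapman--Kolmogorov equation compare two Borel measures with
  equal Fourier transforms, and such measures agree once they are concentrated on compact
  sets, because trigonometric polynomials are uniformly dense on compact sets
  (\<open>borel_prob_eqI\<close>). The same density in \<open>L\<^sup>1\<close> gives strong continuity, since on characters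
  the semigroup is explicit.
\<close>

section \<open>Nonzero functionals by minimal sublinear majorants\<close>

definition sublinear :: "('a::real_vector \<Rightarrow> real) \<Rightarrow> bool" where
  "sublinear p \<longleftrightarrow> (\<forall>x y. p (x + y) \<le> p x + p y) \<and> (\<forall>c\<ge>0. \<forall>x. p (c *\<^sub>R x) = c * p x)"

lemma sublinear_add: "sublinear p \<Longrightarrow> p (x + y) \<le> p x + p y"
  and sublinear_scaleR: "sublinear p \<Longrightarrow> 0 \<le> c \<Longrightarrow> p (c *\<^sub>R x) = c * p x"
  unfolding sublinear_def by auto

lemma sublinear_zero: "sublinear p \<Longrightarrow> p 0 = 0"
  using sublinear_scaleR[of p 0 0] by simp

lemma sublinear_neg: "sublinear p \<Longrightarrow> - p (- x) \<le> p x"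
  using sublinear_add[of p x "- x"] sublinear_zero[of p] by simp

lemma sublinearI:
  assumes add: "\<And>x y. p (x + y) \<le> p x + p y" and zero: "p 0 = 0"
    and scale: "\<And>c x. 0 < c \<Longrightarrow> p (c *\<^sub>R x) \<le> c * p x"
  shows "sublinear p"
  unfolding sublinear_def
proof (intro conjI allI impI add)
  fix c :: real and x assume "0 \<le> c"
  show "p (c *\<^sub>R x) = c * p x"
  proof (cases "c = 0")
    case False
    with \<open>0 \<le> c\<close> have c: "0 < c" by simp
    have "p x = p (inverse c *\<^sub>R (c *\<^sub>R x))" using c by simp
    also have "\<dots> \<le> inverse c * p (c *\<^sub>R x)" using c by (intro scale) simp
    finally have "c * p x \<le> p (c *\<^sub>R x)" using c by (simp add: field_simps)
    with scale[OF c, of x] show ?thesis by simp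
  qed (simp add: zero)
qed

text \<open>
  This is the largest sublinear functional below \<open>p\<close> whose value at \<open>- x\<close> is at most \<open>- p x\<close>. Tilting
  thus forces additivity along \<open>x\<close>, and a functional that no tilt decreases is linear.
\<close>

definition tilt :: "('a::real_vector \<Rightarrow> real) \<Rightarrow> 'a \<Rightarrow> 'a \<Rightarrow> real" where
  "tilt p x y = (INF t\<in>{0..}. p (y + t *\<^sub>R x) - t * p x)"

lemma tilt_bdd_below:
  assumes "sublinear p"
  shows "bdd_below ((\<lambda>t. p (y + t *\<^sub>R x) - t * p x) ` {0..})"
proof (rule bdd_belowI2)
  fix t :: real assume "t \<in> {0..}"
  have "t * p x = p (t *\<^sub>R x)" using \<open>t \<in> {0..}\<close> by (simp add: sublinear_scaleR[OF assms])
  also have "\<dots> = p ((y + t *\<^sub>R x) + - y)" by simp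
  also have "\<dots> \<le> p (y + t *\<^sub>R x) + p (- y)" by (rule sublinear_add[OF assms])
  finally show "- p (- y) \<le> p (y + t *\<^sub>R x) - t * p x" by simp
qed

lemma tilt_le:
  assumes "sublinear p" "0 \<le> t"
  shows "tilt p x y \<le> p (y + t *\<^sub>R x) - t * p x"
  unfolding tilt_def using assms by (intro cINF_lower tilt_bdd_below) auto

lemma tilt_le_self: "sublinear p \<Longrightarrow> tilt p x y \<le> p y"
  using tilt_le[of p 0 x y] by simp

lemma tilt_neg: "sublinear p \<Longrightarrow> tilt p x (- x) \<le> - p x"
  using tilt_le[of p 1 x "- x"] by (simp add: sublinear_zero)

lemma tilt_approx:
  assumes "0 < e"
  obtains t where "0 \<le> t" "p (y + t *\<^sub>R x) - t * p x < tilt p x y + e"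
proof -
  have "(INF t\<in>{0..}. p (y + t *\<^sub>R x) - t * p x) < tilt p x y + e"
    using assms by (simp add: tilt_def)
  from cInf_lessD[OF _ this] show thesis using that by auto
qed

lemma sublinear_tilt:
  assumes p: "sublinear p"
  shows "sublinear (tilt p x)"
proof (rule sublinearI)
  fix y z
  show "tilt p x (y + z) \<le> tilt p x y + tilt p x z"
  proof (rule field_le_epsilon)
    fix e :: real assume "0 < e"
    then have e: "0 < e / 2" by simp
    obtain s where s: "0 \<le> s" "p (y + s *\<^sub>R x) - s * p x < tilt p x y + e / 2"
      using tilt_approx[OF e] by blast
    obtain t where t: "0 \<le> t" "p (z + t *\<^sub>R x) - t * p x < tilt p x z + e / 2"
      using tilt_approx[OF e] by blast
    have "tilt p x (y + z) \<le> p ((y + z) + (s + t) *\<^sub>R x) - (s + t) * p x"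
      using s t by (intro tilt_le p) simp
    also have "(y + z) + (s + t) *\<^sub>R x = (y + s *\<^sub>R x) + (z + t *\<^sub>R x)"
      by (simp add: algebra_simps)
    also have "p \<dots> - (s + t) * p x \<le> (p (y + s *\<^sub>R x) - s * p x) + (p (z + t *\<^sub>R x) - t * p x)"
      using sublinear_add[OF p, of "y + s *\<^sub>R x" "z + t *\<^sub>R x"] by (simp add: distrib_right)
    finally show "tilt p x (y + z) \<le> tilt p x y + tilt p x z + e" using s t by simp
  qed
next
  have "tilt p x 0 \<le> 0" using tilt_le_self[OF p, of x 0] by (simp add: sublinear_zero[OF p])
  moreover have "0 \<le> tilt p x 0"
    unfolding tilt_def by (intro cINF_greatest) (auto simp: sublinear_scaleR[OF p])
  ultimately show "tilt p x 0 = 0" by simp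
next
  fix c :: real and y assume c: "0 < c"
  show "tilt p x (c *\<^sub>R y) \<le> c * tilt p x y"
  proof (rule field_le_epsilon)
    fix e :: real assume "0 < e"
    then have e: "0 < e / c" using c by simp
    obtain t where t: "0 \<le> t" "p (y + t *\<^sub>R x) - t * p x < tilt p x y + e / c"
      using tilt_approx[OF e] by blast
    have "tilt p x (c *\<^sub>R y) \<le> p (c *\<^sub>R y + (c * t) *\<^sub>R x) - (c * t) * p x"
      using t c by (intro tilt_le p) simp
    also have "c *\<^sub>R y + (c * t) *\<^sub>R x = c *\<^sub>R (y + t *\<^sub>R x)" by (simp add: algebra_simps)
    also have "p \<dots> - (c * t) * p x = c * (p (y + t *\<^sub>R x) - t * p x)"
      using c sublinear_scaleR[OF p, of c "y + t *\<^sub>R x"] by (simp only: right_diff_distrib mult.assoc)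
    also have "\<dots> \<le> c * (tilt p x y + e / c)" using t c by (intro mult_left_mono) auto
    also have "\<dots> = c * tilt p x y + e" using c by (simp add: distrib_left)
    finally show "tilt p x (c *\<^sub>R y) \<le> c * tilt p x y + e" .
  qed
qed

text \<open>
  A chain is what makes subadditivity survive the infimum: nearly optimal members for \<open>x\<close> and for \<open>y\<close>
  can be replaced by the smaller of the two.
\<close>

lemma sublinear_Inf_chain:
  fixes C :: "('a::real_vector \<Rightarrow> real) set"
  assumes C: "C \<noteq> {}" "\<And>p. p \<in> C \<Longrightarrow> sublinear p"
    and chain: "\<And>p q. p \<in> C \<Longrightarrow> q \<in> C \<Longrightarrow> (\<forall>x. p x \<le> q x) \<or> (\<forall>x. q x \<le> p x)"
    and bdd: "\<And>x. bdd_below ((\<lambda>p. p x) ` C)"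
  shows "sublinear (\<lambda>x. INF p\<in>C. p x)"
proof -
  let ?i = "\<lambda>x. INF p\<in>C. p x"
  have low: "?i x \<le> p x" if "p \<in> C" for p x
    using bdd that by (intro cINF_lower)
  have app: "\<exists>p\<in>C. p x < ?i x + e" if "0 < e" for x e
    using cInf_lessD[of "(\<lambda>p. p x) ` C" "?i x + e"] C that by auto
  show ?thesis
  proof (rule sublinearI)
    fix x y
    show "?i (x + y) \<le> ?i x + ?i y"
    proof (rule field_le_epsilon)
      fix e :: real assume "0 < e"
      then have e: "0 < e / 2" by simp
      obtain p where p: "p \<in> C" "p x < ?i x + e / 2" using app[OF e] by blast
      obtain q where q: "q \<in> C" "q y < ?i y + e / 2" using app[OF e] by blast
      obtain r where r: "r \<in> C" "r x \<le> p x" "r y \<le> q y" using chain[OF p(1) q(1)] p q by fastforce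
      have "?i (x + y) \<le> r x + r y"
        using low[OF r(1)] sublinear_add[OF C(2)[OF r(1)]] by (rule order_trans)
      then show "?i (x + y) \<le> ?i x + ?i y + e" using r p q by simp
    qed
  next
    show "?i 0 = 0" using C by (simp add: sublinear_zero cong: INF_cong)
  next
    fix c :: real and x assume c: "0 < c"
    show "?i (c *\<^sub>R x) \<le> c * ?i x"
    proof (rule field_le_epsilon)
      fix e :: real assume "0 < e"
      then have e: "0 < e / c" using c by simp
      obtain p where p: "p \<in> C" "p x < ?i x + e / c" using app[OF e] by blast
      have "?i (c *\<^sub>R x) \<le> c * p x"
        using low[OF p(1), of "c *\<^sub>R x"] c by (simp add: sublinear_scaleR[OF C(2)[OF p(1)]])
      also have "\<dots> \<le> c * (?i x + e / c)" using p c by (intro mult_left_mono) auto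
      also have "\<dots> = c * ?i x + e" using c by (simp add: distrib_left)
      finally show "?i (c *\<^sub>R x) \<le> c * ?i x + e" .
    qed
  qed
qed

lemma minimal_sublinear_exists:
  fixes p0 :: "'a::real_vector \<Rightarrow> real"
  assumes p0: "sublinear p0"
  obtains p where "sublinear p" "\<And>x. p x \<le> p0 x"
    "\<And>q. sublinear q \<Longrightarrow> (\<And>x. q x \<le> p x) \<Longrightarrow> q = p"
proof -
  define A where "A = {p. sublinear p \<and> (\<forall>x. p x \<le> p0 x)}"
  define P where "P = (\<lambda>(p::'a \<Rightarrow> real) q. \<forall>x. q x \<le> p x)"
  have "\<exists>m\<in>A. \<forall>a\<in>A. P m a \<longrightarrow> a = m"
  proof (rule predicate_Zorn)
    show "partial_order_on A (relation_of P A)"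
      by (rule partial_order_on_relation_ofI) (auto simp: P_def fun_eq_iff intro: order_trans antisym)
  next
    fix C assume C: "C \<in> Chains (relation_of P A)"
    then have CA: "C \<subseteq> A" by (auto simp: Chains_def relation_of_def)
    show "\<exists>u\<in>A. \<forall>a\<in>C. P a u"
    proof (cases "C = {}")
      case True
      then show ?thesis using p0 by (auto simp: A_def)
    next
      case False
      have bdd: "bdd_below ((\<lambda>p. p x) ` C)" for x
      proof (rule bdd_belowI2)
        fix p assume "p \<in> C"
        then have "sublinear p" "p (- x) \<le> p0 (- x)" using CA by (auto simp: A_def)
        then show "- p0 (- x) \<le> p x" using sublinear_neg[of p x] by simp
      qed
      have sub: "sublinear (\<lambda>x. INF p\<in>C. p x)"
      proof (rule sublinear_Inf_chain[OF False])
        fix p q assume "p \<in> C" "q \<in> C"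
        then show "(\<forall>x. p x \<le> q x) \<or> (\<forall>x. q x \<le> p x)"
          using C by (auto simp: Chains_def relation_of_def P_def)
      qed (use CA bdd in \<open>auto simp: A_def\<close>)
      have low: "(INF p\<in>C. p x) \<le> p x" if "p \<in> C" for p x
        using bdd that by (intro cINF_lower)
      have "(INF p\<in>C. p x) \<le> p0 x" for x
      proof -
        obtain p where "p \<in> C" using False by blast
        then have "(INF p\<in>C. p x) \<le> p x" "p x \<le> p0 x" using low CA by (auto simp: A_def)
        then show ?thesis by (rule order_trans)
      qed
      then show ?thesis using sub low by (intro bexI[of _ "\<lambda>x. INF p\<in>C. p x"]) (auto simp: A_def P_def)
    qed
  qed
  then obtain p where p: "p \<in> A" "\<And>q. q \<in> A \<Longrightarrow> P p q \<Longrightarrow> q = p" by blast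
  show thesis
  proof (rule that[of p])
    show "sublinear p" "p x \<le> p0 x" for x using p by (auto simp: A_def)
    fix q assume "sublinear q" and q: "\<And>x. q x \<le> p x"
    moreover from p have "p x \<le> p0 x" for x by (auto simp: A_def)
    then have "q x \<le> p0 x" for x using q order_trans by blast
    ultimately show "q = p" by (intro p(2)) (auto simp: A_def P_def)
  qed
qed

text \<open>
  A minimal sublinear functional is linear, since it equals all its tilts. Starting
  the descent at the tilt of the norm in the direction \<open>x\<close> keeps the value at \<open>- x\<close> below \<open>- norm x\<close>.
\<close>

lemma exists_functional_nonzero:
  fixes x :: "'a::real_normed_vector"
  assumes "x \<noteq> 0"
  obtains u :: "'a \<Rightarrow>\<^sub>L real" where "u x \<noteq> 0"
proof -
  have nrm: "sublinear (norm :: 'a \<Rightarrow> real)"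
    by (rule sublinearI) (auto simp: norm_triangle_ineq)
  have p0: "sublinear (tilt norm x)" by (rule sublinear_tilt[OF nrm])
  obtain p where p: "sublinear p" and le: "\<And>y. p y \<le> tilt norm x y"
    and min: "\<And>q. sublinear q \<Longrightarrow> (\<And>y. q y \<le> p y) \<Longrightarrow> q = p"
    using minimal_sublinear_exists[OF p0] by blast
  have neg: "p (- y) = - p y" for y
  proof -
    have "tilt p y = p" by (intro min sublinear_tilt p tilt_le_self)
    then have "p (- y) \<le> - p y" using tilt_neg[OF p, of y] by simp
    then show ?thesis using sublinear_neg[OF p, of y] by simp
  qed
  have add: "p (y + z) = p y + p z" for y z
  proof -
    have "p (- y + - z) \<le> p (- y) + p (- z)" by (rule sublinear_add[OF p])
    then have "p y + p z \<le> p (y + z)" using neg[of "y + z"] neg[of y] neg[of z] by simp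
    then show ?thesis using sublinear_add[OF p, of y z] by simp
  qed
  have scale: "p (c *\<^sub>R y) = c * p y" for c y
  proof (cases "0 \<le> c")
    case False
    then have "p (c *\<^sub>R y) = - p ((- c) *\<^sub>R y)" using neg[of "(- c) *\<^sub>R y"] by simp
    also have "\<dots> = c * p y" using False by (subst sublinear_scaleR[OF p]) auto
    finally show ?thesis .
  qed (rule sublinear_scaleR[OF p])
  have le_norm: "p y \<le> norm y" for y using le[of y] tilt_le_self[OF nrm, of x y] by simp
  have "\<bar>p y\<bar> \<le> norm y" for y using le_norm[of y] le_norm[of "- y"] neg[of y] by simp
  then have "bounded_linear p"
    by (intro bounded_linear_intro[of p 1]) (auto simp: add scale)
  moreover have "p (- x) \<le> - norm x" using le[of "- x"] tilt_neg[OF nrm, of x] by simp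
  then have "p x \<noteq> 0" using assms neg[of x] by auto
  ultimately show thesis using that[of "Blinfun p"] by (simp add: bounded_linear_Blinfun_apply)
qed

section \<open>Uniform boundedness and Riesz representation\<close>

lemma uniform_boundedness:
  fixes T :: "'i \<Rightarrow> 'a::banach \<Rightarrow>\<^sub>L 'b::real_normed_vector"
  assumes bdd: "\<And>x. \<exists>C. \<forall>i\<in>I. norm (T i x) \<le> C"
  shows "\<exists>C. \<forall>i\<in>I. norm (T i) \<le> C"
proof -
  \<comment> \<open>By Baire one of the closed sets on which the family is bounded by a constant has interior points.\<close>
  define F where "F = (\<lambda>n::nat. {x. \<forall>i\<in>I. norm (T i x) \<le> real n})"
  have F_closed: "closed (F n)" for n
    unfolding F_def by (simp only: Collect_ball_eq)
      (intro closed_INT ballI closed_Collect_le continuous_intros)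
  have "\<exists>n. x \<in> F n" for x
  proof -
    obtain C where C: "\<forall>i\<in>I. norm (T i x) \<le> C" using bdd by blast
    moreover obtain n :: nat where "C \<le> real n" using real_arch_simple by blast
    ultimately show ?thesis by (auto simp: F_def intro!: exI[of _ n] intro: order_trans)
  qed
  then have UN: "\<Union>(range F) = UNIV" by blast
  have "\<exists>n. interior (F n) \<noteq> {}"
  proof (rule ccontr)
    assume "\<nexists>n. interior (F n) \<noteq> {}"
    then have "euclidean interior_of \<Union>(range F) = {}"
      using F_closed by (intro Baire_category_alt) (auto simp: completely_metrizable_space_euclidean)
    then show False unfolding UN by simp
  qed
  then obtain n a where "a \<in> interior (F n)" by blast
  then obtain r where r: "0 < r" "cball a r \<subseteq> F n"
    using mem_interior_cball by blast
  have "norm (T i) \<le> 2 * real n / r" if i: "i \<in> I" for i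
  proof (rule norm_blinfun_bound)
    show "0 \<le> 2 * real n / r" using r by simp
    fix x
    show "norm (T i x) \<le> 2 * real n / r * norm x"
    proof (cases "x = 0")
      case False
      define c where "c = r / norm x"
      have c: "0 < c" using False r by (simp add: c_def)
      have "a + c *\<^sub>R x \<in> cball a r" using r False by (simp add: dist_norm c_def)
      then have 1: "norm (T i (a + c *\<^sub>R x)) \<le> real n" using r i by (auto simp: F_def)
      have "a \<in> cball a r" using r by simp
      then have 2: "norm (T i a) \<le> real n" using r i by (force simp: F_def)
      have "c * norm (T i x) = norm (T i (a + c *\<^sub>R x) - T i a)"
        using c by (simp add: blinfun.add_right blinfun.scaleR_right)
      also have "\<dots> \<le> 2 * real n" using norm_triangle_ineq4[of "T i (a + c *\<^sub>R x)" "T i a"] 1 2 by simp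
      finally show ?thesis using False r by (simp add: c_def field_simps)
    qed simp
  qed
  then show ?thesis by blast
qed

text \<open>
  The representing vector minimises \<open>(norm g)\<^sup>2 - 2 * l g\<close>: the parallelogram law makes a minimising
  sequence Cauchy, and the first variation at the minimum is the representation formula.
\<close>

lemma riesz_representation:
  fixes l :: "'h::{real_inner,complete_space} \<Rightarrow>\<^sub>L real"
  obtains h where "\<And>g. inner h g = l g"
proof -
  define J where "J = (\<lambda>g. (norm g)\<^sup>2 - 2 * l g)"
  have bd: "- (norm l)\<^sup>2 \<le> J g" for g
  proof -
    have "l g \<le> norm l * norm g" using norm_blinfun[of l g] by simp
    moreover have "0 \<le> (norm g - norm l)\<^sup>2" by simp
    then have "2 * (norm l * norm g) \<le> (norm g)\<^sup>2 + (norm l)\<^sup>2" by (simp add: power2_diff algebra_simps)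
    ultimately show ?thesis unfolding J_def by linarith
  qed
  define m where "m = Inf (range J)"
  have bdd: "bdd_below (range J)" using bd by (rule bdd_belowI2)
  have m: "m \<le> J g" for g unfolding m_def using bdd by (intro cInf_lower) auto
  have "\<exists>g. J g < m + 1 / real (Suc n)" for n
    using cInf_lessD[of "range J" "m + 1 / real (Suc n)"] by (auto simp: m_def)
  then obtain G where G: "\<And>n. J (G n) < m + 1 / real (Suc n)" by metis
  have par: "(norm (g - k))\<^sup>2 = 2 * J g + 2 * J k - 4 * J ((1/2) *\<^sub>R (g + k))" for g k
    unfolding J_def power2_norm_eq_inner
    by (simp add: blinfun.scaleR_right blinfun.add_right inner_add inner_diff inner_commute algebra_simps)
  have "Cauchy G"
  proof (rule metric_CauchyI)
    fix e :: real assume e: "0 < e"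
    obtain N where N: "4 / e\<^sup>2 < real N" using reals_Archimedean2 by blast
    have "dist (G i) (G j) < e" if ij: "i \<ge> N" "j \<ge> N" for i j
    proof -
      have N0: "0 < real N" using N e by (smt (verit) divide_nonneg_nonneg zero_le_power2)
      have small: "1 / real (Suc i) < e\<^sup>2 / 4" if "N \<le> i" for i
      proof -
        have "1 / real (Suc i) < 1 / real N" using that N0 by (simp add: field_simps)
        also have "\<dots> < e\<^sup>2 / 4" using N N0 e by (simp add: field_simps)
        finally show ?thesis .
      qed
      have "(norm (G i - G j))\<^sup>2 < e\<^sup>2"
        using less_trans[OF G[of i] add_strict_left_mono[OF small[OF ij(1)], of m]]
          less_trans[OF G[of j] add_strict_left_mono[OF small[OF ij(2)], of m]]
          m[of "(1/2) *\<^sub>R (G i + G j)"] by (subst par) linarith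
      then show ?thesis using e by (simp add: dist_norm power_less_imp_less_base)
    qed
    then show "\<exists>M. \<forall>m\<ge>M. \<forall>n\<ge>M. dist (G m) (G n) < e" by blast
  qed
  then obtain h where h: "G \<longlonglongrightarrow> h" using Cauchy_convergent convergent_def by blast
  have "(\<lambda>n. J (G n)) \<longlonglongrightarrow> J h" unfolding J_def by (intro tendsto_intros h)
  moreover have "(\<lambda>n. m + 1 / real (Suc n)) \<longlonglongrightarrow> m + 0"
    by (intro tendsto_intros LIMSEQ_inverse_real_of_nat[unfolded inverse_eq_divide])
  ultimately have "J h \<le> m"
    using LIMSEQ_le[of "\<lambda>n. J (G n)" "J h"] G less_imp_le by (metis (no_types, lifting) add_0_right)
  have "inner h g = l g" for g
  proof -
    define d where "d = inner h g - l g"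
    define N where "N = (norm g)\<^sup>2"
    \<comment> \<open>A step against the defect \<open>d\<close>; the summand 1 keeps the quotient meaningful for \<open>g = 0\<close>.\<close>
    define t where "t = - d / (N + 1)"
    have N: "0 \<le> N" by (simp add: N_def)
    have "J h \<le> J (h + t *\<^sub>R g)" using m[of "h + t *\<^sub>R g"] \<open>J h \<le> m\<close> by simp
    also have "J (h + t *\<^sub>R g) = J h + 2 * t * d + t\<^sup>2 * N"
      unfolding J_def d_def N_def power2_norm_eq_inner
      by (simp add: blinfun.scaleR_right blinfun.add_right inner_add inner_commute algebra_simps power2_eq_square)
    finally have "0 \<le> 2 * t * d + t\<^sup>2 * N" by simp
    also have "d = - t * (N + 1)" using N by (simp add: t_def)
    also have "2 * t * (- t * (N + 1)) + t\<^sup>2 * N = - (t\<^sup>2 * (N + 2))"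
      by (simp add: algebra_simps power2_eq_square)
    finally have "t\<^sup>2 * (N + 2) \<le> 0" by simp
    then have "t = 0" using N by (simp add: mult_le_0_iff)
    then have "d = 0" using N by (simp add: t_def)
    then show ?thesis by (simp add: d_def)
  qed
  then show thesis by (rule that)
qed

section \<open>Strongly continuous semigroups and eigenvectors of the adjoint generator\<close>

lemma C0_zero: "c0_semigroup S \<Longrightarrow> S 0 x = x"
  and C0_add: "c0_semigroup S \<Longrightarrow> 0 \<le> s \<Longrightarrow> 0 \<le> t \<Longrightarrow> S (s + t) x = S s (S t x)"
  and C0_tendsto: "c0_semigroup S \<Longrightarrow> ((\<lambda>t. S t x) \<longlongrightarrow> x) (at_right 0)"
  unfolding c0_semigroup_def by auto

text \<open>
  Otherwise \<open>norm (S t)\<close> would be unbounded along some sequence \<open>t \<longlonglongrightarrow> 0\<close>, although all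
  orbits converge along it; this is what the uniform boundedness principle excludes.
\<close>

lemma C0_bounded_near_0:
  assumes S: "c0_semigroup S"
  obtains d M where "0 < d" "\<And>t. 0 \<le> t \<Longrightarrow> t \<le> d \<Longrightarrow> norm (S t) \<le> M"
proof -
  have "\<exists>n::nat. \<forall>t\<in>{0..1 / Suc n}. norm (S t) \<le> real n"
  proof (rule ccontr)
    assume "\<nexists>n::nat. \<forall>t\<in>{0..1 / Suc n}. norm (S t) \<le> real n"
    then have "\<forall>n::nat. \<exists>t. t \<in> {0..1 / Suc n} \<and> real n < norm (S t)" by (metis not_le)
    then obtain t where t: "\<And>n::nat. t n \<in> {0..1 / Suc n}" "\<And>n. real n < norm (S (t n))" by metis
    have t0: "t \<longlonglongrightarrow> 0"
    proof (rule tendsto_sandwich[of "\<lambda>_. 0" t sequentially "\<lambda>n. 1 / Suc n"])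
      show "(\<lambda>n. 1 / real (Suc n)) \<longlonglongrightarrow> 0" using LIMSEQ_inverse_real_of_nat by (simp add: inverse_eq_divide)
    qed (use t in auto)
    have "\<exists>C. \<forall>n\<in>UNIV. norm (S (t n) x) \<le> C" for x
    proof -
      have "((\<lambda>s. S s x) \<longlongrightarrow> S 0 x) (at 0 within {0..})"
        using C0_tendsto[OF S, of x] by (simp add: C0_zero[OF S] at_within_Ici_at_right)
      then have "continuous (at 0 within {0..}) (\<lambda>s. S s x)" by (simp add: continuous_within)
      then have "(\<lambda>n. S (t n) x) \<longlonglongrightarrow> S 0 x"
        using t0 t(1) unfolding continuous_within_sequentially by (auto simp: o_def)
      then have "bounded (range (\<lambda>n. S (t n) x))" by (rule convergent_imp_bounded)
      then show ?thesis by (auto simp: bounded_iff)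
    qed
    then have "\<exists>C. \<forall>n\<in>UNIV. norm (S (t n)) \<le> C" by (rule uniform_boundedness)
    then obtain C where C: "\<And>n. norm (S (t n)) \<le> C" by auto
    obtain n :: nat where "C < real n" using reals_Archimedean2 by blast
    then show False using C[of n] t(2)[of n] by simp
  qed
  then obtain n :: nat where "\<forall>t\<in>{0..1 / Suc n}. norm (S t) \<le> real n" by blast
  then show thesis by (intro that[of "1 / Suc n" "real n"]) auto
qed

lemma C0_locally_bounded:
  assumes S: "c0_semigroup S"
  obtains M where "0 \<le> M" "\<And>t. 0 \<le> t \<Longrightarrow> t \<le> T \<Longrightarrow> norm (S t) \<le> M"
proof -
  obtain d M where d: "0 < d" and M: "\<And>t. 0 \<le> t \<Longrightarrow> t \<le> d \<Longrightarrow> norm (S t) \<le> M"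
    using C0_bounded_near_0[OF S] by blast
  have M0: "0 \<le> M" using M[of 0] d norm_ge_zero[of "S 0"] by linarith
  have bd: "norm (S t) \<le> (M + 1) ^ Suc n" if "0 \<le> t" "t \<le> real (Suc n) * d" for n t
    using that
  proof (induction n arbitrary: t)
    case 0
    then show ?case using M[of t] by simp
  next
    case (Suc n)
    have one: "1 \<le> (M + 1) ^ Suc n" using M0 by (intro one_le_power) simp
    show ?case
    proof (cases "t \<le> d")
      case True
      have "norm (S t) \<le> M + 1" using M Suc True by force
      also have "\<dots> \<le> (M + 1) * (M + 1) ^ Suc n" using one M0 by (simp add: mult_le_cancel_left1 del: power_Suc)
      finally show ?thesis by simp
    next
      case False
      have "S t = S d o\<^sub>L S (t - d)"
        using S d False unfolding c0_semigroup_def by (metis add.commute diff_add_cancel diff_ge_0_iff_ge less_imp_le not_le)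
      then have "norm (S t) \<le> norm (S d) * norm (S (t - d))" by (simp add: norm_blinfun_compose)
      also have "\<dots> \<le> (M + 1) * (M + 1) ^ Suc n"
        using M[of d] d M0 False Suc.prems by (intro mult_mono Suc.IH) (auto simp: algebra_simps)
      finally show ?thesis by simp
    qed
  qed
  obtain n :: nat where n: "T / d < real n" using reals_Archimedean2 by blast
  then have "T \<le> real (Suc n) * d" using d by (simp add: field_simps)
  then show thesis using bd[of _ n] M0 by (intro that[of "(M + 1) ^ Suc n"]) auto
qed

lemma C0_continuous_on:
  assumes S: "c0_semigroup S"
  shows "continuous_on {0..} (\<lambda>t. S t x)"
  unfolding continuous_on_iff
proof (intro ballI allI impI)
  fix t e :: real assume "t \<in> {0..}" and e: "0 < e"
  then have t: "0 \<le> t" by simp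
  obtain M where M0: "0 \<le> M" and M: "\<And>s. 0 \<le> s \<Longrightarrow> s \<le> t + 1 \<Longrightarrow> norm (S s) \<le> M"
    using C0_locally_bounded[OF S] by blast
  have "\<forall>\<^sub>F h in at_right 0. dist (S h x) x < e / (M + 1)"
    using C0_tendsto[OF S, of x] e M0 by (intro tendstoD) auto
  then obtain b where b: "0 < b" "\<And>h. 0 < h \<Longrightarrow> h < b \<Longrightarrow> dist (S h x) x < e / (M + 1)"
    unfolding eventually_at_right_field by auto
  have key: "dist (S (s + h) x) (S s x) < e" if "0 \<le> s" "s \<le> t + 1" "0 \<le> h" "h < b" for s h
  proof -
    have small: "norm (S h x - x) < e / (M + 1)"
      using b(2)[of h] that e M0 by (cases "h = 0") (auto simp: dist_norm C0_zero[OF S])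
    have "dist (S (s + h) x) (S s x) = norm (S s (S h x - x))"
      using that by (simp add: C0_add[OF S] dist_norm blinfun.diff_right)
    also have "\<dots> \<le> norm (S s) * norm (S h x - x)" by (rule norm_blinfun)
    also have "\<dots> \<le> M * norm (S h x - x)" using M[OF that(1,2)] by (intro mult_right_mono) auto
    also have "\<dots> \<le> M * (e / (M + 1))" using small M0 by (intro mult_left_mono) auto
    also have "\<dots> < e" using e M0 by (simp add: field_simps)
    finally show ?thesis .
  qed
  show "\<exists>d>0. \<forall>s\<in>{0..}. dist s t < d \<longrightarrow> dist (S s x) (S t x) < e"
  proof (intro exI[of _ "min b 1"] conjI ballI impI)
    fix s :: real assume s: "s \<in> {0..}" "dist s t < min b 1"
    show "dist (S s x) (S t x) < e"
    proof (cases "s \<le> t")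
      case True
      then show ?thesis using key[of s "t - s"] s t by (simp add: dist_real_def dist_commute)
    next
      case False
      then show ?thesis using key[of t "s - t"] s t by (simp add: dist_real_def)
    qed
  qed (use b in simp)
qed

lemma integral_right_derivative:
  fixes f :: "real \<Rightarrow> 'a::banach"
  assumes f: "continuous_on {0..} f" and r: "0 \<le> r"
  shows "((\<lambda>h. (integral {0..r + h} f - integral {0..r} f) /\<^sub>R h) \<longlongrightarrow> f r) (at_right 0)"
proof -
  let ?I = "\<lambda>u. integral {0..u} f"
  have "(?I has_vector_derivative f r) (at r within {0..r + 1})"
    using r by (intro integral_has_vector_derivative continuous_on_subset[OF f]) auto
  then have "(?I has_vector_derivative f r) (at r within {r..r + 1})"
    by (rule has_vector_derivative_within_subset) (use r in auto)
  moreover have "at r within {r..r + 1} = at_right r"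
    by (rule at_within_Icc_at_right) simp
  ultimately have "(?I has_vector_derivative f r) (at_right r)" by simp
  then have "((\<lambda>y. ((?I y - ?I r) - (y - r) *\<^sub>R f r) /\<^sub>R norm (y - r)) \<longlongrightarrow> 0) (at_right r)"
    by (simp add: has_vector_derivative_def has_derivative_at_within)
  then have "((\<lambda>h. ((?I (r + h) - ?I r) - h *\<^sub>R f r) /\<^sub>R norm h) \<longlongrightarrow> 0) (at_right 0)"
    by (subst (asm) at_right_to_0) (simp add: filterlim_filtermap add.commute)
  then have "((\<lambda>h. (?I (r + h) - ?I r) /\<^sub>R h - f r) \<longlongrightarrow> 0) (at_right 0)"
    by (rule Lim_transform_eventually)
      (auto simp: eventually_at_right_field scaleR_diff_right intro!: exI[of _ 1])
  then show ?thesis by (rule LIM_zero_cancel)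
qed

text \<open>
  Applying \<open>S h\<close> to the integral of an orbit shifts the interval of integration, so the difference
  quotient only sees the two ends of the interval.
\<close>

lemma C0_integral_in_generator:
  assumes S: "c0_semigroup S" and r: "0 \<le> r"
  shows "(integral {0..r} (\<lambda>h. S h x), S r x - x) \<in> generator S"
proof -
  let ?f = "\<lambda>h. S h x"
  let ?I = "\<lambda>u. integral {0..u} ?f"
  have c: "continuous_on {0..} ?f" by (rule C0_continuous_on[OF S])
  have int: "?f integrable_on {a..b}" if "0 \<le> a" for a b
    using that by (intro integrable_continuous_real continuous_on_subset[OF c]) auto
  have eq: "(S h (?I r) - ?I r) /\<^sub>R h = (?I (r + h) - ?I r) /\<^sub>R h - (?I (0 + h) - ?I 0) /\<^sub>R h"
    if h: "0 < h" for h
  proof -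
    have "S h (?I r) = integral {0..r} (blinfun_apply (S h) \<circ> ?f)"
      by (intro integral_linear[symmetric] int blinfun.bounded_linear_right) simp
    also have "\<dots> = integral {0..r} (?f \<circ> (+) h)"
      using h by (intro integral_cong) (simp add: C0_add[OF S])
    also have "\<dots> = integral {h..r + h} ?f"
    proof -
      have "(?f has_integral integral {h..r + h} ?f) (cbox h (r + h))"
        using int[of h "r + h"] h by (simp add: has_integral_integral)
      from has_integral_affinity'[OF this, of 1 h] show ?thesis
        by (intro integral_unique) (simp add: o_def add.commute)
    qed
    also have "\<dots> = ?I (r + h) - ?I h"
      using Henstock_Kurzweil_Integration.integral_combine[where a = 0 and c = h and b = "r + h" and f = ?f] int r h by (simp add: algebra_simps)
    finally show ?thesis by (simp add: scaleR_diff_right)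
  qed
  have "((\<lambda>h. (?I (r + h) - ?I r) /\<^sub>R h - (?I (0 + h) - ?I 0) /\<^sub>R h) \<longlongrightarrow> S r x - S 0 x) (at_right 0)"
    by (intro tendsto_diff integral_right_derivative c r order_refl)
  then have "((\<lambda>h. (S h (?I r) - ?I r) /\<^sub>R h) \<longlongrightarrow> S r x - S 0 x) (at_right 0)"
    by (rule Lim_transform_eventually) (use eq in \<open>auto simp: eventually_at_right_field intro!: exI[of _ 1]\<close>)
  then show ?thesis by (simp add: generator_def C0_zero[OF S])
qed

lemma adjoint_generator_integral:
  assumes S: "c0_semigroup S" and uv: "(u, v) \<in> adjoint_op (generator S)" and r: "0 \<le> r"
  shows "u (S r x) = u x + integral {0..r} (\<lambda>h. v (S h x))"
proof -
  have "u (S r x - x) = v (integral {0..r} (\<lambda>h. S h x))"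
    using uv C0_integral_in_generator[OF S r, of x] by (auto simp: adjoint_op_def)
  also have "\<dots> = integral {0..r} (blinfun_apply v \<circ> (\<lambda>h. S h x))"
    by (intro integral_linear[symmetric] integrable_continuous_real blinfun.bounded_linear_right
        continuous_on_subset[OF C0_continuous_on[OF S]]) auto
  finally show ?thesis by (simp add: blinfun.diff_right o_def)
qed

text \<open>
  Pairing an orbit with the eigenvector gives a scalar solution of \<open>F' = l F\<close>. The eigenvalue equation is used on integrated
  orbits, which lie in the domain of the generator for every \<open>x\<close>, and so gives \<open>F' = l F\<close> in integrated form.
\<close>

lemma C0_adjoint_eigenvector:
  fixes l :: complex
  assumes S: "c0_semigroup S"
    and z: "((u1, u2), cscale l (u1, u2)) \<in> complexify_op (adjoint_op (generator S))"
    and r: "0 \<le> r"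
  shows "Complex (u1 (S r x)) (u2 (S r x)) = exp (l * r) * Complex (u1 x) (u2 x)"
proof -
  define a b where "a = Re l" and "b = Im l"
  define F where "F = (\<lambda>r. Complex (u1 (S r x)) (u2 (S r x)))"
  have z1: "(u1, a *\<^sub>R u1 - b *\<^sub>R u2) \<in> adjoint_op (generator S)"
    and z2: "(u2, b *\<^sub>R u1 + a *\<^sub>R u2) \<in> adjoint_op (generator S)"
    using z by (auto simp: complexify_op_def cscale_def a_def b_def)
  have cont: "continuous_on {0..} (\<lambda>h. u (S h x))" for u :: "'a \<Rightarrow>\<^sub>L real"
    by (intro continuous_intros C0_continuous_on[OF S])
  have der: "((\<lambda>r. u (S r x)) has_vector_derivative v (S s x)) (at s within {0..r})"
    if uv: "(u, v) \<in> adjoint_op (generator S)" and s: "s \<in> {0..r}" for u v s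
  proof -
    have "((\<lambda>r. u x + integral {0..r} (\<lambda>h. v (S h x))) has_vector_derivative 0 + v (S s x)) (at s within {0..r})"
      using s by (intro has_vector_derivative_add has_vector_derivative_const
          integral_has_vector_derivative continuous_on_subset[OF cont]) auto
    then show ?thesis
      using has_vector_derivative_transform[OF s, of "\<lambda>r. u (S r x)"] adjoint_generator_integral[OF S uv]
      by (metis (no_types, lifting) add_0 atLeastAtMost_iff)
  qed
  have dF: "(F has_vector_derivative l * F s) (at s within {0..r})" if s: "s \<in> {0..r}" for s
  proof -
    have "((\<lambda>r. of_real (u1 (S r x)) + \<i> * of_real (u2 (S r x))) has_vector_derivative
        of_real ((a *\<^sub>R u1 - b *\<^sub>R u2) (S s x)) + \<i> * of_real ((b *\<^sub>R u1 + a *\<^sub>R u2) (S s x))) (at s within {0..r})"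
      by (intro has_vector_derivative_add has_vector_derivative_of_real has_vector_derivative_mult_right der[OF z1 s, folded has_real_derivative_iff_has_vector_derivative]
          der[OF z2 s, folded has_real_derivative_iff_has_vector_derivative])
    moreover have "of_real ((a *\<^sub>R u1 - b *\<^sub>R u2) (S s x)) + \<i> * of_real ((b *\<^sub>R u1 + a *\<^sub>R u2) (S s x)) = l * F s"
      by (simp add: F_def a_def b_def complex_eq_iff blinfun.bilinear_simps)
    moreover have "(\<lambda>r. of_real (u1 (S r x)) + \<i> * of_real (u2 (S r x))) = F"
      by (simp add: F_def fun_eq_iff complex_eq_iff)
    ultimately show ?thesis by simp
  qed
  have e: "((\<lambda>s. exp (- l * of_real s)) has_vector_derivative - l * exp (- l * of_real s)) (at s within {0..r})" for s
    by (auto intro!: derivative_eq_intros has_vector_derivative_real_field)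
  have "((\<lambda>s. exp (- l * of_real s) * F s) has_vector_derivative 0) (at s within {0..r})" if "s \<in> {0..r}" for s
    using has_vector_derivative_mult[OF e[of s] dF[OF that]] by (simp add: algebra_simps)
  then obtain c where c: "\<And>s. s \<in> {0..r} \<Longrightarrow> exp (- l * of_real s) * F s = c"
    using has_vector_derivative_zero_constant[of "{0..r}" "\<lambda>s. exp (- l * of_real s) * F s"] by (metis convex_closed_interval convex_real_interval(5))
  have "exp (- l * of_real r) * F r = exp (- l * of_real 0) * F 0"
    using c[of r] c[of 0] r by simp
  then have "exp (l * r) * exp (- l * of_real r) * F r = exp (l * r) * F 0" by simp
  then show ?thesis by (simp add: F_def C0_zero[OF S] exp_add[symmetric])
qed

section \<open>Trigonometric polynomials and uniqueness of measures\<close>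

text \<open>
  The real trigonometric polynomials. They are generated by sums and multiples alone, because an induction over
  these suffices to compare integrals; closure under products follows from the addition theorems.
\<close>

inductive_set trig :: "('a::real_normed_vector \<Rightarrow> real) set" where
  trig_cos: "(\<lambda>x. cos (blinfun_apply u x)) \<in> trig"
| trig_sin: "(\<lambda>x. sin (blinfun_apply u x)) \<in> trig"
| trig_scale: "f \<in> trig \<Longrightarrow> (\<lambda>x. c * f x) \<in> trig"
| trig_add: "f \<in> trig \<Longrightarrow> g \<in> trig \<Longrightarrow> (\<lambda>x. f x + g x) \<in> trig"

lemma trig_const: "(\<lambda>_. c) \<in> trig"
  using trig_scale[OF trig_cos[of 0], of c] by simp

lemma trig_diff: "f \<in> trig \<Longrightarrow> g \<in> trig \<Longrightarrow> (\<lambda>x. f x - g x) \<in> trig"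
  using trig_add[OF _ trig_scale[of g "-1"], of f] by simp

lemma trig_mult:
  assumes "f \<in> trig" "g \<in> trig"
  shows "(\<lambda>x. f x * g x) \<in> trig"
proof -
  have half: "(\<lambda>x. h x / 2) \<in> trig" if "h \<in> trig" for h :: "'a \<Rightarrow> real"
    using trig_scale[OF that, of "1/2"] by simp
  have cc: "(\<lambda>x. cos (u x) * cos (v x)) \<in> trig" and ss: "(\<lambda>x. sin (u x) * sin (v x)) \<in> trig"
    and sc: "(\<lambda>x. sin (u x) * cos (v x)) \<in> trig" for u v :: "'a \<Rightarrow>\<^sub>L real"
    using half[OF trig_add[OF trig_cos[of "u - v"] trig_cos[of "u + v"]]]
      half[OF trig_diff[OF trig_cos[of "u - v"] trig_cos[of "u + v"]]]
      half[OF trig_add[OF trig_sin[of "u + v"] trig_sin[of "u - v"]]]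
    by (simp_all add: cos_times_cos sin_times_sin sin_times_cos blinfun.bilinear_simps)
  have cos_mult: "(\<lambda>x. cos (u x) * g x) \<in> trig" for u :: "'a \<Rightarrow>\<^sub>L real"
    using assms(2)
  proof induction
    case (trig_cos v)
    show ?case by (rule cc)
  next
    case (trig_sin v)
    show ?case using sc[of v u] by (simp add: mult.commute)
  next
    case (trig_scale f c)
    show ?case using trig.trig_scale[OF trig_scale.IH, of c] by (simp add: algebra_simps)
  next
    case (trig_add f g)
    show ?case using trig.trig_add[OF trig_add.IH] by (simp add: algebra_simps)
  qed
  have sin_mult: "(\<lambda>x. sin (u x) * g x) \<in> trig" for u :: "'a \<Rightarrow>\<^sub>L real"
    using assms(2)
  proof induction
    case (trig_cos v)
    show ?case by (rule sc)
  next
    case (trig_sin v)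
    show ?case by (rule ss)
  next
    case (trig_scale f c)
    show ?case using trig.trig_scale[OF trig_scale.IH, of c] by (simp add: algebra_simps)
  next
    case (trig_add f g)
    show ?case using trig.trig_add[OF trig_add.IH] by (simp add: algebra_simps)
  qed
  show ?thesis
    using assms(1)
  proof induction
    case (trig_scale f c)
    show ?case using trig.trig_scale[OF trig_scale.IH, of c] by (simp add: algebra_simps)
  next
    case (trig_add f h)
    show ?case using trig.trig_add[OF trig_add.IH] by (simp add: algebra_simps)
  qed (rule cos_mult sin_mult)+
qed

lemma trig_continuous: "f \<in> trig \<Longrightarrow> continuous_on UNIV f"
  by (induction rule: trig.induct) (intro continuous_intros; assumption?)+

lemma trig_measurable: "f \<in> trig \<Longrightarrow> f \<in> borel_measurable borel"
  by (intro borel_measurable_continuous_onI trig_continuous)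

lemma trig_bounded: "f \<in> trig \<Longrightarrow> \<exists>C. \<forall>x. \<bar>f x\<bar> \<le> C"
proof (induction rule: trig.induct)
  case (trig_scale f c)
  then obtain C where "\<forall>x. \<bar>f x\<bar> \<le> C" by blast
  then show ?case by (intro exI[of _ "\<bar>c\<bar> * C"]) (simp add: abs_mult mult_left_mono)
next
  case (trig_add f g)
  then obtain C D where "\<forall>x. \<bar>f x\<bar> \<le> C" "\<forall>x. \<bar>g x\<bar> \<le> D" by blast
  then show ?case by (intro exI[of _ "C + D"]) (meson abs_triangle_ineq add_mono order_trans)
qed (auto intro: exI[of _ 1])

lemma trig_polynomial:
  assumes "real_polynomial_function p" "g \<in> trig"
  shows "(\<lambda>x. p (g x :: real)) \<in> trig"
  using assms(1)
proof induction
  case (linear f)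
  interpret bounded_linear f by fact
  have "f (g x) = f 1 * g x" for x using scaleR[of "g x" 1] by simp
  then show ?case using trig_scale[OF assms(2), of "f 1"] by simp
qed (auto intro: trig_const trig_add trig_mult)

lemma trig_separates:
  fixes x y :: "'a::real_normed_vector"
  assumes "x \<noteq> y"
  shows "\<exists>f\<in>trig. f x \<noteq> f y"
proof -
  obtain u :: "'a \<Rightarrow>\<^sub>L real" where u: "u (x - y) \<noteq> 0"
    using exists_functional_nonzero[of "x - y"] assms by auto
  \<comment> \<open>Rescale the functional so that its values at \<open>x\<close> and \<open>y\<close> differ by a quarter turn.\<close>
  define c where "c = pi / (2 * u (x - y))"
  have "cos ((c *\<^sub>R u) (x - y)) = 0" using u by (simp add: c_def blinfun.scaleR_left)
  then have ne: "cos ((c *\<^sub>R u) x - (c *\<^sub>R u) y) \<noteq> 1" by (simp add: blinfun.diff_right)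
  show ?thesis
  proof (rule ccontr)
    assume "\<not> ?thesis"
    then have "cos ((c *\<^sub>R u) x) = cos ((c *\<^sub>R u) y)" "sin ((c *\<^sub>R u) x) = sin ((c *\<^sub>R u) y)"
      using trig_cos[of "c *\<^sub>R u"] trig_sin[of "c *\<^sub>R u"] by auto
    then show False using ne by (simp add: cos_diff flip: power2_eq_square)
  qed
qed

text \<open>
  The approximant given by the Stone--Weierstrass theorem is uncontrolled outside \<open>K\<close>. Composing it with a
  polynomial that is close to the clamping function on its whole (bounded) range yields a trigonometric
  polynomial that is bounded everywhere and still close to \<open>f\<close> on \<open>K\<close>.
\<close>

lemma trig_approx_compact:
  fixes f :: "'a::real_normed_vector \<Rightarrow> real"
  assumes K: "compact K" and f: "continuous_on K f" "\<And>x. x \<in> K \<Longrightarrow> 0 \<le> f x \<and> f x \<le> 1" and e: "0 < e"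
  obtains g where "g \<in> trig" "\<And>x. x \<in> K \<Longrightarrow> \<bar>f x - g x\<bar> < e" "\<And>x. \<bar>g x\<bar> \<le> 1 + e"
proof -
  interpret function_ring_on trig K
    by standard (use K trig_separates trig_const in
        \<open>auto intro: trig_add trig_mult continuous_on_subset[OF trig_continuous]\<close>)
  obtain g where g: "g \<in> trig" "\<And>x. x \<in> K \<Longrightarrow> \<bar>f x - g x\<bar> < e / 2"
    using Stone_Weierstrass_basic[OF f(1), of "e / 2"] e by auto
  obtain C where C: "\<And>x. \<bar>g x\<bar> \<le> C" using trig_bounded[OF g(1)] by blast
  \<comment> \<open>Clamping to the unit interval does not increase the distance to \<open>f\<close>, whose values lie there.\<close>
  define cl where "cl = (\<lambda>y::real. min 1 (max 0 y))"
  have "continuous_on {-C..C} cl" unfolding cl_def by (intro continuous_intros)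
  then obtain p where p: "real_polynomial_function p" "\<And>y. y \<in> {-C..C} \<Longrightarrow> \<bar>cl y - p y\<bar> < e / 2"
    using Stone_Weierstrass_real_polynomial_function[of "{-C..C}" cl "e / 2"] e by auto
  have pg: "\<bar>cl (g x) - p (g x)\<bar> < e / 2" for x
    using C[of x] by (intro p) (auto simp: abs_le_iff)
  show thesis
  proof (rule that[of "\<lambda>x. p (g x)"])
    show "(\<lambda>x. p (g x)) \<in> trig" by (rule trig_polynomial[OF p(1) g(1)])
    show "\<bar>f x - p (g x)\<bar> < e" if "x \<in> K" for x
    proof -
      have "\<bar>f x - cl (g x)\<bar> \<le> \<bar>f x - g x\<bar>" using f(2)[OF that] by (auto simp: cl_def)
      then show ?thesis using pg[of x] g(2)[OF that] by linarith
    qed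
    show "\<bar>p (g x)\<bar> \<le> 1 + e" for x
    proof -
      have "\<bar>cl (g x)\<bar> \<le> 1" by (auto simp: cl_def)
      then show ?thesis using pg[of x] e by linarith
    qed
  qed
qed

definition borel_prob :: "'a::topological_space measure \<Rightarrow> bool" where
  "borel_prob M \<longleftrightarrow> prob_space M \<and> sets M = sets borel"

lemma borel_prob_space: "borel_prob M \<Longrightarrow> prob_space M"
  and borel_prob_sets: "borel_prob M \<Longrightarrow> sets M = sets borel"
  by (auto simp: borel_prob_def)

lemma borel_prob_univ: "borel_prob M \<Longrightarrow> space M = UNIV"
  by (auto simp: borel_prob_def dest: sets_eq_imp_space_eq)

lemma borel_prob_measurable: "borel_prob M \<Longrightarrow> f \<in> measurable borel N \<Longrightarrow> f \<in> measurable M N"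
  using measurable_cong_sets[OF borel_prob_sets refl, of M N] by blast

lemma borel_prob_integrable:
  fixes f :: "'a::topological_space \<Rightarrow> 'b::{banach, second_countable_topology}"
  assumes M: "borel_prob M" and f: "f \<in> borel_measurable borel" "\<And>x. norm (f x) \<le> C"
  shows "integrable M f"
proof -
  interpret prob_space M using M by (rule borel_prob_space)
  show ?thesis
    by (rule integrable_const_bound[of _ C]) (use f borel_prob_measurable[OF M] in auto)
qed

text \<open>
  Tightness of a single measure.
\<close>

definition compactly_concentrated :: "'a::topological_space measure \<Rightarrow> bool" where
  "compactly_concentrated M \<longleftrightarrow> (\<forall>e>0. \<exists>K. compact K \<and> measure M (- K) < e)"

lemma trig_integrable: "borel_prob M \<Longrightarrow> g \<in> trig \<Longrightarrow> integrable M g"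
  using trig_bounded[of g] by (metis borel_prob_integrable trig_measurable real_norm_def)

lemma integral_abs_approx:
  fixes f g :: "'a::{t2_space, real_normed_vector} \<Rightarrow> real"
  assumes M: "borel_prob M" and K: "compact K" "measure M (- K) < e"
    and m: "f \<in> borel_measurable borel" "g \<in> borel_measurable borel"
    and fg: "\<And>x. x \<in> K \<Longrightarrow> \<bar>f x - g x\<bar> < e" "\<And>x. \<bar>f x\<bar> \<le> 1" "\<And>x. \<bar>g x\<bar> \<le> 2"
  shows "(\<integral>x. \<bar>f x - g x\<bar> \<partial>M) \<le> 4 * e"
proof -
  interpret prob_space M using M by (rule borel_prob_space)
  have Kb: "- K \<in> sets M" using K by (simp add: borel_prob_sets[OF M] compact_imp_closed borel_comp)
  have e: "0 < e" using K measure_nonneg[of M "- K"] by linarith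
  have "(\<integral>x. \<bar>f x - g x\<bar> \<partial>M) \<le> (\<integral>x. e + 3 * indicator (- K) x \<partial>M)"
  proof (rule integral_mono)
    show "integrable M (\<lambda>x. \<bar>f x - g x\<bar>)"
    proof (rule borel_prob_integrable[OF M])
      show "norm \<bar>f x - g x\<bar> \<le> 3" for x using fg(2,3)[of x] by simp
    qed (use m in measurable)
    show "integrable M (\<lambda>x. e + 3 * indicator (- K) x)" using Kb by (auto simp: emeasure_eq_measure)
    show "\<bar>f x - g x\<bar> \<le> e + 3 * indicator (- K) x" for x
      using fg(1)[of x] fg(2,3)[of x] e by (cases "x \<in> K") auto
  qed
  also have "\<dots> = e + 3 * measure M (- K)"
    using Kb by (subst Bochner_Integration.integral_add) (auto simp: emeasure_eq_measure prob_space[unfolded borel_prob_univ[OF M]] borel_prob_univ[OF M])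
  finally show ?thesis using K by simp
qed

text \<open>
  Two measures are treated at once, so that comparing them only needs one approximant.
\<close>

lemma trig_approx_continuous:
  fixes f :: "'a::{t2_space, real_normed_vector} \<Rightarrow> real"
  assumes M: "borel_prob M" "compactly_concentrated M" and N: "borel_prob N" "compactly_concentrated N"
    and f: "continuous_on UNIV f" "\<And>x. 0 \<le> f x \<and> f x \<le> 1" and e: "0 < e"
  obtains g where "g \<in> trig" "(\<integral>x. \<bar>f x - g x\<bar> \<partial>M) < e" "(\<integral>x. \<bar>f x - g x\<bar> \<partial>N) < e"
proof -
  define d where "d = min 1 (e / 8)"
  have d: "0 < d" "d \<le> 1" "4 * d < e" using e by (auto simp: d_def)
  obtain K where K: "compact K" "measure M (- K) < d" using M d by (auto simp: compactly_concentrated_def)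
  obtain L where L: "compact L" "measure N (- L) < d" using N d by (auto simp: compactly_concentrated_def)
  have KL: "compact (K \<union> L)" using K L by (intro compact_Un)
  have b: "- K \<in> sets borel" "- L \<in> sets borel" "- (K \<union> L) \<in> sets borel"
    using K L KL by (auto intro!: borel_open simp: compact_imp_closed open_Compl simp del: Compl_Un)
  interpret M: prob_space M using M by (intro borel_prob_space)
  interpret N: prob_space N using N by (intro borel_prob_space)
  have m: "measure M (- (K \<union> L)) < d" "measure N (- (K \<union> L)) < d"
    using M.finite_measure_mono[of "- (K \<union> L)" "- K"] N.finite_measure_mono[of "- (K \<union> L)" "- L"] b K L
    by (auto simp: borel_prob_sets M N)
  have f': "continuous_on (K \<union> L) f" using f by (auto intro: continuous_on_subset)
  obtain g where g: "g \<in> trig" "\<And>x. x \<in> K \<union> L \<Longrightarrow> \<bar>f x - g x\<bar> < d" "\<And>x. \<bar>g x\<bar> \<le> 1 + d"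
    using trig_approx_compact[OF KL f' f(2) d(1)] by blast
  have bd: "\<bar>f x\<bar> \<le> 1" "\<bar>g x\<bar> \<le> 2" for x using f(2)[of x] g(3)[of x] d by auto
  have meas: "f \<in> borel_measurable borel" "g \<in> borel_measurable borel"
    using f g by (auto intro: borel_measurable_continuous_onI trig_measurable)
  show thesis
    using integral_abs_approx[OF M(1) KL m(1) meas g(2) bd] integral_abs_approx[OF N(1) KL m(2) meas g(2) bd] d
    by (intro that[OF g(1)]) auto
qed

lemma continuous_approx_closed:
  fixes F :: "'a::{real_normed_vector} set"
  assumes M: "borel_prob M" and N: "borel_prob N" and F: "closed F" and e: "0 < e"
  obtains f where "continuous_on UNIV f" "\<And>x. 0 \<le> f x \<and> f x \<le> (1::real)"
    "(\<integral>x. \<bar>indicator F x - f x\<bar> \<partial>M) < e" "(\<integral>x. \<bar>indicator F x - f x\<bar> \<partial>N) < e"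
proof (cases "F = {}")
  case True
  then show thesis using e by (intro that[of "\<lambda>_. 0"]) auto
next
  case False
  \<comment> \<open>The empty set is treated apart because its \<open>infdist\<close> is zero by convention.\<close>
  define f where "f = (\<lambda>(n::nat) x. max 0 (1 - real n * infdist x F))"
  have cf: "continuous_on UNIV (f n)" for n unfolding f_def by (intro continuous_intros)
  have bf: "0 \<le> f n x \<and> f n x \<le> 1" for n x by (simp add: f_def infdist_nonneg)
  have Fb: "F \<in> sets borel" using F by auto
  have lim: "(\<lambda>n. f n x) \<longlonglongrightarrow> indicator F x" for x
  proof (cases "x \<in> F")
    case True
    then show ?thesis by (simp add: f_def)
  next
    case xF: False
    then have pos: "0 < infdist x F" using F False by (simp add: infdist_pos_not_in_closed)
    obtain k :: nat where k: "1 < real k * infdist x F" using pos reals_Archimedean3 by blast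
    have "f n x = 0" if "k \<le> n" for n
    proof -
      have "real k * infdist x F \<le> real n * infdist x F" using that pos by (intro mult_right_mono) auto
      then show ?thesis using k by (simp add: f_def)
    qed
    then show ?thesis using xF by (intro tendsto_eventually) (auto simp: eventually_sequentially)
  qed
  have "\<forall>\<^sub>F n in sequentially. (\<integral>x. \<bar>indicator F x - f n x\<bar> \<partial>P) < e" if P: "borel_prob P" for P
  proof -
    interpret prob_space P using P by (rule borel_prob_space)
    have "(\<lambda>n. \<integral>x. \<bar>indicator F x - f n x\<bar> \<partial>P) \<longlonglongrightarrow> (\<integral>x. 0 \<partial>P)"
    proof (rule integral_dominated_convergence[where w = "\<lambda>_. 1"])
      show "(\<lambda>x. \<bar>indicator F x - f n x\<bar>) \<in> borel_measurable P" for n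
      proof (rule borel_prob_measurable[OF P])
        note [measurable] = borel_measurable_continuous_onI[OF cf[of n]] Fb
        show "(\<lambda>x. \<bar>indicator F x - f n x\<bar>) \<in> borel_measurable borel" by measurable
      qed
      show "AE x in P. (\<lambda>n. \<bar>indicator F x - f n x\<bar>) \<longlonglongrightarrow> 0"
      proof (intro AE_I2 tendsto_rabs_zero)
        fix x show "(\<lambda>n. indicator F x - f n x) \<longlonglongrightarrow> 0"
          using tendsto_diff[OF tendsto_const[of "indicator F x"] lim[of x]] by simp
      qed
      show "AE x in P. norm \<bar>indicator F x - f n x\<bar> \<le> 1" for n
      proof (rule AE_I2)
        fix x show "norm \<bar>indicator F x - f n x\<bar> \<le> 1"
          using bf[of n x] by (auto simp: indicator_def abs_le_iff)
      qed
    qed auto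
    then show ?thesis using e by (intro order_tendstoD(2)[where y = "0::real"]) auto
  qed
  from eventually_conj[OF this[OF M] this[OF N]] obtain n where
    "(\<integral>x. \<bar>indicator F x - f n x\<bar> \<partial>M) < e" "(\<integral>x. \<bar>indicator F x - f n x\<bar> \<partial>N) < e"
    by (auto dest: eventually_happens)
  then show thesis using cf bf by (intro that) auto
qed

lemma integral_abs_triangle:
  fixes f g h :: "'a \<Rightarrow> real"
  assumes "integrable M f" "integrable M g" "integrable M h"
  shows "(\<integral>x. \<bar>f x - h x\<bar> \<partial>M) \<le> (\<integral>x. \<bar>f x - g x\<bar> \<partial>M) + (\<integral>x. \<bar>g x - h x\<bar> \<partial>M)"
proof -
  have "(\<integral>x. \<bar>f x - h x\<bar> \<partial>M) \<le> (\<integral>x. \<bar>f x - g x\<bar> + \<bar>g x - h x\<bar> \<partial>M)"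
    using assms by (intro integral_mono) auto
  also have "\<dots> = (\<integral>x. \<bar>f x - g x\<bar> \<partial>M) + (\<integral>x. \<bar>g x - h x\<bar> \<partial>M)"
    using assms by (intro Bochner_Integration.integral_add) auto
  finally show ?thesis .
qed

lemma trig_approx_closed:
  fixes F :: "'a::{real_normed_vector} set"
  assumes M: "borel_prob M" "compactly_concentrated M" and N: "borel_prob N" "compactly_concentrated N"
    and F: "closed F" and e: "0 < e"
  obtains g where "g \<in> trig" "(\<integral>x. \<bar>indicator F x - g x\<bar> \<partial>M) < e" "(\<integral>x. \<bar>indicator F x - g x\<bar> \<partial>N) < e"
proof -
  have e2: "0 < e / 2" using e by simp
  obtain f where f: "continuous_on UNIV f" "\<And>x. 0 \<le> f x \<and> f x \<le> (1::real)"
    "(\<integral>x. \<bar>indicator F x - f x\<bar> \<partial>M) < e / 2" "(\<integral>x. \<bar>indicator F x - f x\<bar> \<partial>N) < e / 2"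
    using continuous_approx_closed[OF M(1) N(1) F e2] by blast
  obtain g where g: "g \<in> trig" "(\<integral>x. \<bar>f x - g x\<bar> \<partial>M) < e / 2" "(\<integral>x. \<bar>f x - g x\<bar> \<partial>N) < e / 2"
    using trig_approx_continuous[OF M N f(1,2) e2] by blast
  have "(\<integral>x. \<bar>indicator F x - g x\<bar> \<partial>P) \<le> (\<integral>x. \<bar>indicator F x - f x\<bar> \<partial>P) + (\<integral>x. \<bar>f x - g x\<bar> \<partial>P)"
    if P: "borel_prob P" for P
  proof (rule integral_abs_triangle)
    show "integrable P (indicator F :: _ \<Rightarrow> real)"
      using F by (intro borel_prob_integrable[OF P, of _ 1]) (auto simp: indicator_def)
    show "integrable P f"
      using f by (intro borel_prob_integrable[OF P, of _ 1]) (auto intro: borel_measurable_continuous_onI)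
  qed (rule trig_integrable[OF P g(1)])
  from this[OF M(1)] this[OF N(1)] show thesis using f g by (intro that[OF g(1)]) auto
qed

text \<open>
  Uniqueness of the Fourier transform. Without separability this needs the concentration on compact sets, since
  the Borel sets may be finer than the sets that the functionals generate.
\<close>

lemma borel_prob_eqI:
  fixes M N :: "'a::real_normed_vector measure"
  assumes M: "borel_prob M" "compactly_concentrated M" and N: "borel_prob N" "compactly_concentrated N"
    and c: "\<And>u :: 'a \<Rightarrow>\<^sub>L real. (\<integral>x. cos (u x) \<partial>M) = (\<integral>x. cos (u x) \<partial>N)"
    and s: "\<And>u :: 'a \<Rightarrow>\<^sub>L real. (\<integral>x. sin (u x) \<partial>M) = (\<integral>x. sin (u x) \<partial>N)"
  shows "M = N"
proof -
  interpret M: prob_space M using M by (intro borel_prob_space)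
  interpret N: prob_space N using N by (intro borel_prob_space)
  have eq: "(\<integral>x. g x \<partial>M) = (\<integral>x. g x \<partial>N)" if "g \<in> trig" for g
    using that by induction (simp_all add: c s trig_integrable[OF M(1)] trig_integrable[OF N(1)])
  have closed: "measure M F = measure N F" if F: "closed F" for F
  proof -
    have "\<bar>measure M F - measure N F\<bar> \<le> e" if e: "0 < e" for e :: real
    proof -
      have "0 < e / 2" using e by simp
      then obtain g where g: "g \<in> trig" "(\<integral>x. \<bar>indicator F x - g x\<bar> \<partial>M) < e / 2"
        "(\<integral>x. \<bar>indicator F x - g x\<bar> \<partial>N) < e / 2"
        using trig_approx_closed[OF M N F] by blast
      have "\<bar>measure P F - (\<integral>x. g x \<partial>P)\<bar> \<le> (\<integral>x. \<bar>indicator F x - g x\<bar> \<partial>P)" if P: "borel_prob P" for P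
      proof -
        have int: "integrable P (indicator F :: _ \<Rightarrow> real)"
          using F by (intro borel_prob_integrable[OF P, of _ 1]) (auto simp: indicator_def)
        then have "measure P F - (\<integral>x. g x \<partial>P) = (\<integral>x. indicator F x - g x \<partial>P)"
          using trig_integrable[OF P g(1)] by (simp add: borel_prob_univ[OF P])
        then show ?thesis by simp
      qed
      from this[OF M(1)] this[OF N(1)] show ?thesis using g eq[OF g(1)] by linarith
    qed
    then show ?thesis using field_le_epsilon[of "\<bar>measure M F - measure N F\<bar>" 0] by simp
  qed
  show ?thesis
  proof (rule measure_eqI_generator_eq[where E = "{F. closed F}" and \<Omega> = UNIV and A = "\<lambda>_. UNIV"])
    show "Int_stable {F :: 'a set. closed F}" by (auto simp: Int_stable_def)
    show "sets M = sigma_sets UNIV {F. closed F}" "sets N = sigma_sets UNIV {F. closed F}"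
      by (simp_all add: borel_prob_sets M N borel_eq_closed)
  qed (auto simp: M.emeasure_eq_measure N.emeasure_eq_measure closed)
qed

text \<open>
  Inner regularity replaces a Borel set by a compact, hence closed, one.
\<close>

lemma trig_approx_set:
  fixes A :: "'a::{real_normed_vector} set"
  assumes M: "borel_prob M"
    and reg: "\<forall>A\<in>sets borel. emeasure M A = (SUP K\<in>{K. compact K \<and> K \<subseteq> A}. emeasure M K)"
    and cc: "compactly_concentrated M" and A: "A \<in> sets borel" and e: "0 < e"
  obtains g where "g \<in> trig" "(\<integral>x. \<bar>indicator A x - g x\<bar> \<partial>M) < e"
proof -
  interpret M: prob_space M using M by (rule borel_prob_space)
  have e2: "0 < e / 2" using e by simp
  have "\<exists>K. compact K \<and> K \<subseteq> A \<and> measure M A - e / 2 < measure M K"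
  proof (rule ccontr)
    assume "\<not> ?thesis"
    then have le: "measure M K \<le> measure M A - e / 2" if "compact K" "K \<subseteq> A" for K
      using that by (meson not_le)
    have "emeasure M A \<le> ennreal (measure M A - e / 2)"
      using le by (subst reg[rule_format, OF A]) (auto intro!: SUP_least ennreal_leI simp: M.emeasure_eq_measure)
    moreover have "0 \<le> measure M A - e / 2" using le[of "{}"] by simp
    ultimately show False using e2 by (simp add: M.emeasure_eq_measure)
  qed
  then obtain K where K: "compact K" "K \<subseteq> A" "measure M A - e / 2 < measure M K" by blast
  then have cK: "closed K" by (intro compact_imp_closed)
  obtain g where g: "g \<in> trig" "(\<integral>x. \<bar>indicator K x - g x\<bar> \<partial>M) < e / 2"
    using trig_approx_closed[OF M cc M cc cK e2] by blast
  have int: "integrable M (indicator B :: _ \<Rightarrow> real)" if "B \<in> sets borel" for B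
    using that by (intro borel_prob_integrable[OF M, of _ 1]) (auto simp: indicator_def)
  have Kb: "K \<in> sets borel" using cK by auto
  have "(\<integral>x. \<bar>indicator A x - g x\<bar> \<partial>M) \<le> (\<integral>x. \<bar>indicator A x - indicator K x\<bar> \<partial>M) + (\<integral>x. \<bar>indicator K x - g x\<bar> \<partial>M)"
    by (intro integral_abs_triangle int A Kb trig_integrable[OF M g(1)])
  also have "(\<integral>x. \<bar>indicator A x - indicator K x\<bar> \<partial>M) = (\<integral>x. indicator A x - (indicator K x :: real) \<partial>M)"
    using K by (intro Bochner_Integration.integral_cong) (auto simp: indicator_def)
  also have "\<dots> = measure M A - measure M K"
    using int[OF A] int[OF Kb] by (simp add: borel_prob_univ[OF M])
  finally show thesis using K g by (intro that[OF g(1)]) auto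
qed

section \<open>Integration against kernels\<close>

lemma AE_integrable_bind:
  fixes f :: "'b \<Rightarrow> 'c::{banach, second_countable_topology}"
  assumes K: "K \<in> measurable M (subprob_algebra N)" and M: "space M \<noteq> {}"
    and f: "integrable (bind M K) f"
  shows "AE x in M. integrable (K x) f"
proof -
  have sb: "sets (bind M K) = sets N" using sets_bind[OF sets_kernel[OF K] M] by simp
  have fm: "f \<in> borel_measurable N" using borel_measurable_integrable[OF f] sb by (simp cong: measurable_cong_sets)
  have "(\<integral>\<^sup>+x. \<integral>\<^sup>+y. norm (f y) \<partial>K x \<partial>M) = (\<integral>\<^sup>+y. norm (f y) \<partial>bind M K)"
    using fm by (subst nn_integral_bind[OF _ K]) auto
  also have "\<dots> < \<infinity>" using f by (simp add: integrable_iff_bounded)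
  finally have "AE x in M. (\<integral>\<^sup>+y. norm (f y) \<partial>K x) \<noteq> \<infinity>"
    using fm by (intro nn_integral_PInf_AE measurable_compose[OF K nn_integral_measurable_subprob_algebra]) auto
  then show ?thesis
    using AE_space
  proof eventually_elim
    case (elim x)
    show ?case
    proof (rule integrableI_bounded)
      show "f \<in> borel_measurable (K x)"
        using fm measurable_cong_sets[OF sets_kernel[OF K elim(2)] refl] by blast
      show "(\<integral>\<^sup>+y. norm (f y) \<partial>K x) < \<infinity>" using elim(1) by (simp add: less_top)
    qed
  qed
qed

lemma
  fixes f :: "'b \<Rightarrow> 'c::{banach, second_countable_topology}"
  assumes K: "K \<in> measurable M (subprob_algebra N)" and M: "space M \<noteq> {}"
    and f: "integrable (bind M K) f"
  shows integrable_integral_kernel: "integrable M (\<lambda>x. \<integral>y. f y \<partial>K x)"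
    and integrable_integral_norm_kernel: "integrable M (\<lambda>x. \<integral>y. norm (f y) \<partial>K x)"
proof -
  have sb: "sets (bind M K) = sets N" using sets_bind[OF sets_kernel[OF K] M] by simp
  have fm: "f \<in> borel_measurable N" using borel_measurable_integrable[OF f] sb by (simp cong: measurable_cong_sets)
  have fin: "(\<integral>\<^sup>+x. \<integral>\<^sup>+y. norm (f y) \<partial>K x \<partial>M) < \<infinity>"
    using f fm by (subst nn_integral_bind[OF _ K, symmetric]) (auto simp: integrable_iff_bounded)
  have ae: "AE x in M. integrable (K x) f" by (rule AE_integrable_bind[OF K M f])
  show "integrable M (\<lambda>x. \<integral>y. norm (f y) \<partial>K x)"
  proof (rule integrableI_bounded)
    show "(\<lambda>x. \<integral>y. norm (f y) \<partial>K x) \<in> borel_measurable M"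
      using fm by (intro measurable_compose[OF K integral_measurable_subprob_algebra]) auto
    have "(\<integral>\<^sup>+x. norm (\<integral>y. norm (f y) \<partial>K x) \<partial>M) \<le> (\<integral>\<^sup>+x. \<integral>\<^sup>+y. norm (f y) \<partial>K x \<partial>M)"
      by (intro nn_integral_mono_AE, use ae in eventually_elim) (simp add: nn_integral_eq_integral)
    then show "(\<integral>\<^sup>+x. norm (\<integral>y. norm (f y) \<partial>K x) \<partial>M) < \<infinity>" using fin by simp
  qed
  show "integrable M (\<lambda>x. \<integral>y. f y \<partial>K x)"
  proof (rule integrableI_bounded)
    show "(\<lambda>x. \<integral>y. f y \<partial>K x) \<in> borel_measurable M"
      using fm by (intro measurable_compose[OF K integral_measurable_subprob_algebra]) auto
    have "(\<integral>\<^sup>+x. norm (\<integral>y. f y \<partial>K x) \<partial>M) \<le> (\<integral>\<^sup>+x. \<integral>\<^sup>+y. norm (f y) \<partial>K x \<partial>M)"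
      by (intro nn_integral_mono_AE, use ae in eventually_elim) (simp add: nn_integral_eq_integral integral_norm_bound)
    then show "(\<integral>\<^sup>+x. norm (\<integral>y. f y \<partial>K x) \<partial>M) < \<infinity>" using fin by simp
  qed
qed

text \<open>
  Fubini's theorem for kernels and integrable, possibly unbounded, functions.
\<close>

lemma integral_bind_kernel:
  fixes f :: "'b \<Rightarrow> 'c::{banach, second_countable_topology}"
  assumes K: "K \<in> measurable M (subprob_algebra N)" and M: "space M \<noteq> {}" "subprob_space M"
    and f: "integrable (bind M K) f"
  shows "(\<integral>y. f y \<partial>bind M K) = (\<integral>x. \<integral>y. f y \<partial>K x \<partial>M)"
  using f
proof induction
  case (base A c)
  have sb: "sets (bind M K) = sets N" using sets_bind[OF sets_kernel[OF K] M(1)] by simp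
  interpret subprob_space M by fact
  have A: "A \<in> sets N" using base sb by simp
  have s: "A \<in> sets (K x)" "A \<inter> space (K x) = A" if "x \<in> space M" for x
    using sets_kernel[OF K that] A sets.sets_into_space[of A "K x"] by auto
  have fin: "finite_measure (K x)" if "x \<in> space M" for x
    using measurable_space[OF K that] by (simp add: space_subprob_algebra subprob_space.axioms(1))
  have sp: "A \<inter> space (bind M K) = A" using sets.sets_into_space[OF base(1)] by auto
  have "(\<integral>y. indicator A y *\<^sub>R c \<partial>bind M K) = measure (bind M K) A *\<^sub>R c"
    using base sp by simp
  also have "\<dots> = (\<integral>x. measure (K x) A \<partial>M) *\<^sub>R c" by (simp add: measure_bind[OF K A])
  also have "\<dots> = (\<integral>x. measure (K x) A *\<^sub>R c \<partial>M)"
  proof (rule integral_scaleR_left[symmetric])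
    show "integrable M (\<lambda>x. measure (K x) A)"
    proof (rule integrable_const_bound[of _ 1])
      show "(\<lambda>x. measure (K x) A) \<in> borel_measurable M"
        using A by (intro measurable_compose[OF K measurable_measure_subprob_algebra])
      show "AE x in M. norm (measure (K x) A) \<le> 1"
        using measurable_space[OF K] by (auto simp: space_subprob_algebra subprob_space.subprob_measure_le_1)
    qed
  qed
  also have "\<dots> = (\<integral>x. \<integral>y. indicator A y *\<^sub>R c \<partial>K x \<partial>M)"
    using s fin by (intro Bochner_Integration.integral_cong)
      (auto simp: finite_measure.emeasure_eq_measure less_top[symmetric])
  finally show ?case .
next
  case (add f g)
  have "(\<integral>x. \<integral>y. f y + g y \<partial>K x \<partial>M) = (\<integral>x. (\<integral>y. f y \<partial>K x) + (\<integral>y. g y \<partial>K x) \<partial>M)"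
  proof (rule integral_cong_AE)
    show "AE x in M. (\<integral>y. f y + g y \<partial>K x) = (\<integral>y. f y \<partial>K x) + (\<integral>y. g y \<partial>K x)"
      using AE_integrable_bind[OF K M(1) add.hyps(1)] AE_integrable_bind[OF K M(1) add.hyps(2)]
      by eventually_elim simp
  qed (intro borel_measurable_integrable Bochner_Integration.integrable_add
      integrable_integral_kernel[OF K M(1)] add.hyps)+
  also have "\<dots> = (\<integral>x. \<integral>y. f y \<partial>K x \<partial>M) + (\<integral>x. \<integral>y. g y \<partial>K x \<partial>M)"
    using add.hyps integrable_integral_kernel[OF K M(1)] by (intro Bochner_Integration.integral_add) auto
  finally show ?case using add by simp
next
  case (lim f s)
  have sb: "sets (bind M K) = sets N" using sets_bind[OF sets_kernel[OF K] M(1)] by simp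
  then have sp: "space (bind M K) = space N" by (rule sets_eq_imp_space_eq)
  have spK: "space (K x) = space N" if "x \<in> space M" for x
    using sets_kernel[OF K that] by (rule sets_eq_imp_space_eq)
  have bd: "norm (s i y) \<le> 2 * norm (f y)" and cv: "(\<lambda>i. s i y) \<longlonglongrightarrow> f y" if "y \<in> space N" for i y
    using lim that by (auto simp: sp)
  have meas: "h \<in> borel_measurable (K x)" if "integrable (bind M K) h" "x \<in> space M" for h :: "'b \<Rightarrow> 'c" and x
    using borel_measurable_integrable[OF that(1)] sets_kernel[OF K that(2)] sb by (auto cong: measurable_cong_sets)
  have 1: "(\<lambda>i. \<integral>y. s i y \<partial>bind M K) \<longlonglongrightarrow> (\<integral>y. f y \<partial>bind M K)"
    by (rule integral_dominated_convergence[where w = "\<lambda>y. 2 * norm (f y)"])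
      (use lim bd cv in \<open>auto simp: sp\<close>)
  have 2: "(\<lambda>i. \<integral>x. \<integral>y. s i y \<partial>K x \<partial>M) \<longlonglongrightarrow> (\<integral>x. \<integral>y. f y \<partial>K x \<partial>M)"
  proof (rule integral_dominated_convergence[where w = "\<lambda>x. 2 * (\<integral>y. norm (f y) \<partial>K x)"])
    show "integrable M (\<lambda>x. 2 * (\<integral>y. norm (f y) \<partial>K x))"
      using integrable_integral_norm_kernel[OF K M(1) lim.hyps(4)] by simp
    show "AE x in M. (\<lambda>i. \<integral>y. s i y \<partial>K x) \<longlonglongrightarrow> (\<integral>y. f y \<partial>K x)"
      using AE_integrable_bind[OF K M(1) lim.hyps(4)] AE_space
    proof eventually_elim
      case (elim x)
      show ?case
        by (rule integral_dominated_convergence[where w = "\<lambda>y. 2 * norm (f y)"])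
          (use elim bd cv meas lim in \<open>auto simp: spK\<close>)
    qed
    show "AE x in M. norm (\<integral>y. s i y \<partial>K x) \<le> 2 * (\<integral>y. norm (f y) \<partial>K x)" for i
      using AE_integrable_bind[OF K M(1) lim.hyps(4)] AE_integrable_bind[OF K M(1) lim.hyps(1)[of i]] AE_space
    proof eventually_elim
      case (elim x)
      have "norm (\<integral>y. s i y \<partial>K x) \<le> (\<integral>y. norm (s i y) \<partial>K x)" by (rule integral_norm_bound)
      also have "\<dots> \<le> (\<integral>y. 2 * norm (f y) \<partial>K x)"
        using elim bd by (intro integral_mono) (auto simp: spK)
      finally show ?case by simp
    qed
  qed (intro borel_measurable_integrable integrable_integral_kernel[OF K M(1)] lim.hyps)+
  show ?case using LIMSEQ_unique[OF 1] 2 lim by simp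
qed

section \<open>Translation kernels and Gaussian convolution\<close>

definition shift_kernel :: "('a::real_normed_vector \<Rightarrow>\<^sub>L 'b::real_normed_vector) \<Rightarrow> 'b measure \<Rightarrow> 'a \<Rightarrow> 'b measure" where
  "shift_kernel L N x = distr N borel (\<lambda>y. L x + y)"

lemma borel_measurable_shift: "(\<lambda>y. a + y :: 'b::real_normed_vector) \<in> borel_measurable borel"
  by (intro borel_measurable_continuous_onI continuous_intros)

lemma borel_prob_shift_kernel:
  assumes "borel_prob N"
  shows "borel_prob (shift_kernel L N x)"
proof -
  have "prob_space (shift_kernel L N x)"
    unfolding shift_kernel_def
    by (rule prob_space.prob_space_distr[OF borel_prob_space[OF assms] borel_prob_measurable[OF assms borel_measurable_shift]])
  then show ?thesis by (simp add: borel_prob_def shift_kernel_def)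
qed

lemma integral_shift_kernel:
  fixes f :: "'b::real_normed_vector \<Rightarrow> 'c::{banach, second_countable_topology}"
  assumes "borel_prob N" "f \<in> borel_measurable borel"
  shows "(\<integral>y. f y \<partial>shift_kernel L N x) = (\<integral>y. f (L x + y) \<partial>N)"
  unfolding shift_kernel_def
  by (rule integral_distr[OF borel_prob_measurable[OF assms(1) borel_measurable_shift] assms(2)])

lemma emeasure_shift_kernel:
  assumes "borel_prob N" "A \<in> sets borel"
  shows "emeasure (shift_kernel L N x) A = emeasure N {y. L x + y \<in> A}"
  unfolding shift_kernel_def
  by (subst emeasure_distr[OF borel_prob_measurable[OF assms(1) borel_measurable_shift] assms(2)])
    (simp add: borel_prob_univ[OF assms(1)] vimage_def)

text \<open>
  Addition need not be measurable for the product of the Borel algebras when the space is not separable.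
  The measure of an open set is lower semicontinuous in \<open>x\<close> by Fatou's lemma, which makes it measurable.
\<close>

lemma emeasure_shift_kernel_open_lsc:
  fixes L :: "'a::real_normed_vector \<Rightarrow>\<^sub>L 'b::real_normed_vector"
  assumes N: "borel_prob N" and U: "open U"
  shows "closed {x. emeasure (shift_kernel L N x) U \<le> c}"
  unfolding closed_sequential_limits
proof (intro allI impI, elim conjE)
  fix X l assume X: "\<forall>n. X n \<in> {x. emeasure (shift_kernel L N x) U \<le> c}" and l: "X \<longlonglongrightarrow> l"
  define V where "V = (\<lambda>x. (\<lambda>y. L x + y) -` U)"
  have "open (V x)" for x
    unfolding V_def by (intro open_vimage U continuous_intros)
  then have Vm: "V x \<in> sets N" for x using borel_prob_sets[OF N] by simp
  have em: "emeasure (shift_kernel L N x) U = emeasure N (V x)" for x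
    using U by (subst emeasure_shift_kernel[OF N]) (auto simp: V_def vimage_def)
  have "emeasure N (V l) = (\<integral>\<^sup>+y. indicator (V l) y \<partial>N)" using Vm by simp
  also have "\<dots> \<le> (\<integral>\<^sup>+y. liminf (\<lambda>n. indicator (V (X n)) y) \<partial>N)"
  proof (intro nn_integral_mono)
    fix y
    show "indicator (V l) y \<le> liminf (\<lambda>n. indicator (V (X n)) y :: ennreal)"
    proof (cases "y \<in> V l")
      case True
      have "(\<lambda>n. L (X n) + y) \<longlonglongrightarrow> L l + y" by (intro tendsto_intros l)
      then have "\<forall>\<^sub>F n in sequentially. L (X n) + y \<in> U"
        using U True by (intro topological_tendstoD) (auto simp: V_def)
      then have "\<forall>\<^sub>F n in sequentially. (1::ennreal) \<le> indicator (V (X n)) y"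
        by eventually_elim (simp add: V_def)
      then show ?thesis using True by (simp add: Liminf_bounded)
    qed simp
  qed
  also have "\<dots> \<le> liminf (\<lambda>n. \<integral>\<^sup>+y. indicator (V (X n)) y \<partial>N)"
    using Vm by (intro nn_integral_liminf) auto
  also have "\<dots> = liminf (\<lambda>n. emeasure N (V (X n)))" using Vm by simp
  also have "\<dots> \<le> c" using X by (intro Liminf_le) (auto simp: em)
  finally show "l \<in> {x. emeasure (shift_kernel L N x) U \<le> c}" by (simp add: em)
qed

lemma measurable_shift_kernel:
  assumes N: "borel_prob N"
  shows "shift_kernel L N \<in> measurable borel (subprob_algebra borel)"
proof (rule measurable_subprob_algebra_generated[where \<Omega> = UNIV and G = "{U. open U}"])
  show "sets borel = sigma_sets UNIV {U. open U}" by (rule sets_borel)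
  show "Int_stable {U. open U}" by (auto simp: Int_stable_def)
  show "subprob_space (shift_kernel L N a)" "sets (shift_kernel L N a) = sets borel" for a
    using borel_prob_shift_kernel[OF N, of L a]
    by (auto simp: borel_prob_def prob_space_imp_subprob_space)
  show "(\<lambda>a. emeasure (shift_kernel L N a) U) \<in> borel_measurable borel" if "U \<in> {U. open U}" for U
    using emeasure_shift_kernel_open_lsc[OF N, of U L] that
    by (intro borel_measurableI_le) (auto intro: borel_closed)
  then show "(\<lambda>a. emeasure (shift_kernel L N a) UNIV) \<in> borel_measurable borel" by simp
qed simp

text \<open>
  The centered Gaussian measure with variances \<open>q\<close>, described by its Fourier transform \<open>exp (- q u / 2)\<close>. With
  \<open>q = 0\<close> it is the point mass at zero, the law at time \<open>0\<close>.
\<close>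

definition gaussian_form :: "'a::real_normed_vector measure \<Rightarrow> (('a \<Rightarrow>\<^sub>L real) \<Rightarrow> real) \<Rightarrow> bool" where
  "gaussian_form M q \<longleftrightarrow> borel_prob M \<and> compactly_concentrated M \<and>
     (\<forall>u. (\<integral>x. cos (blinfun_apply u x) \<partial>M) = exp (- q u / 2) \<and> (\<integral>x. sin (blinfun_apply u x) \<partial>M) = 0)"

lemma gaussian_form_unique: "gaussian_form M q \<Longrightarrow> gaussian_form N q \<Longrightarrow> M = N"
  unfolding gaussian_form_def by (intro borel_prob_eqI) auto

lemma gaussian_form_return: "gaussian_form (return borel 0) (\<lambda>_. 0)"
  unfolding gaussian_form_def
proof (intro conjI allI)
  show "borel_prob (return borel 0)" by (simp add: borel_prob_def prob_space_return)
  show "compactly_concentrated (return borel (0::'a))"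
    unfolding compactly_concentrated_def
    by (intro allI impI exI[of _ "{0}"]) (simp add: measure_return)
  fix u :: "'a \<Rightarrow>\<^sub>L real"
  show "(\<integral>x. cos (blinfun_apply u x) \<partial>return borel 0) = exp (- 0 / 2)"
    using trig_measurable[OF trig_cos] by (subst integral_return) auto
  show "(\<integral>x. sin (blinfun_apply u x) \<partial>return borel 0) = 0"
    using trig_measurable[OF trig_sin] by (subst integral_return) auto
qed

lemma integral_trig_shift_kernel:
  assumes N: "gaussian_form N b"
  shows "(\<integral>z. cos (blinfun_apply u z) \<partial>shift_kernel L N x) = exp (- b u / 2) * cos ((u o\<^sub>L L) x)"
    and "(\<integral>z. sin (blinfun_apply u z) \<partial>shift_kernel L N x) = exp (- b u / 2) * sin ((u o\<^sub>L L) x)"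
proof -
  have bN: "borel_prob N" and i: "(\<integral>x. cos (blinfun_apply u x) \<partial>N) = exp (- b u / 2)" "(\<integral>x. sin (blinfun_apply u x) \<partial>N) = 0"
    using N by (auto simp: gaussian_form_def)
  note [simp] = trig_integrable[OF bN trig_cos] trig_integrable[OF bN trig_sin]
  show "(\<integral>z. cos (u z) \<partial>shift_kernel L N x) = exp (- b u / 2) * cos ((u o\<^sub>L L) x)"
    by (subst integral_shift_kernel[OF bN trig_measurable[OF trig_cos]])
      (simp add: blinfun.add_right cos_add i)
  show "(\<integral>z. sin (u z) \<partial>shift_kernel L N x) = exp (- b u / 2) * sin ((u o\<^sub>L L) x)"
    by (subst integral_shift_kernel[OF bN trig_measurable[OF trig_sin]])
      (simp add: blinfun.add_right sin_add i)
qed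

lemma borel_prob_bind:
  assumes M: "borel_prob M" and N: "borel_prob N"
  shows "borel_prob (bind M (shift_kernel L N))"
proof -
  have m: "shift_kernel L N \<in> measurable M (subprob_algebra borel)"
    by (rule borel_prob_measurable[OF M measurable_shift_kernel[OF N]])
  show ?thesis
    unfolding borel_prob_def
  proof
    show "prob_space (bind M (shift_kernel L N))"
      by (rule prob_space.prob_space_bind[OF borel_prob_space[OF M] AE_I2 m])
        (rule borel_prob_space[OF borel_prob_shift_kernel[OF N]])
    show "sets (bind M (shift_kernel L N)) = sets borel"
    proof (rule sets_bind)
      show "sets (shift_kernel L N x) = sets borel" for x
        by (rule borel_prob_sets[OF borel_prob_shift_kernel[OF N]])
      show "space M \<noteq> {}" unfolding borel_prob_univ[OF M] by simp
    qed
  qed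
qed

text \<open>
  If \<open>K\<close> and \<open>J\<close> carry almost all the mass of \<open>M\<close> and \<open>N\<close>, then the compact set \<open>L K + J\<close> carries
  almost all the mass of the composition.
\<close>

lemma compactly_concentrated_bind:
  fixes L :: "'a::real_normed_vector \<Rightarrow>\<^sub>L 'b::real_normed_vector"
  assumes M: "borel_prob M" "compactly_concentrated M" and N: "borel_prob N" "compactly_concentrated N"
  shows "compactly_concentrated (bind M (shift_kernel L N))"
  unfolding compactly_concentrated_def
proof (intro allI impI)
  fix e :: real assume "0 < e"
  then have e: "0 < e / 2" by simp
  obtain K where K: "compact K" "measure M (- K) < e / 2" using M(2) e unfolding compactly_concentrated_def by blast
  obtain J where J: "compact J" "measure N (- J) < e / 2" using N(2) e unfolding compactly_concentrated_def by blast
  define C where "C = {a + b |a b. a \<in> L ` K \<and> b \<in> J}"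
  have C: "compact C"
    unfolding C_def by (intro compact_sums compact_continuous_image continuous_intros K J)
  have b: "- C \<in> sets borel" "- K \<in> sets borel" "- J \<in> sets borel"
    using C K J by (auto intro!: borel_comp simp: compact_imp_closed)
  interpret M: prob_space M using M by (intro borel_prob_space)
  interpret N: prob_space N using N by (intro borel_prob_space)
  have m: "shift_kernel L N \<in> measurable M (subprob_algebra borel)"
    by (rule borel_prob_measurable[OF M(1) measurable_shift_kernel[OF N(1)]])
  have p: "prob_space (shift_kernel L N x)" for x by (intro borel_prob_space borel_prob_shift_kernel N)
  have le: "measure (shift_kernel L N x) (- C) \<le> indicator (- K) x + measure N (- J)" for x
  proof (cases "x \<in> K")
    case True
    have "measure (shift_kernel L N x) (- C) = measure N {y. L x + y \<in> - C}"
      using emeasure_shift_kernel[OF N(1) b(1), of L x] by (simp add: measure_def)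
    also have "\<dots> \<le> measure N (- J)"
      using True b by (intro N.finite_measure_mono) (auto simp: C_def borel_prob_sets[OF N(1)])
    finally show ?thesis using True by simp
  next
    case False
    then show ?thesis using prob_space.prob_le_1[OF p, of x "- C"] by (simp add: add_increasing2)
  qed
  have "measure (bind M (shift_kernel L N)) (- C) = (\<integral>x. measure (shift_kernel L N x) (- C) \<partial>M)"
    by (rule M.measure_bind[OF m b(1)])
  also have "\<dots> \<le> (\<integral>x. indicator (- K) x + measure N (- J) \<partial>M)"
  proof (rule integral_mono[OF _ _ le])
    show "integrable M (\<lambda>x. measure (shift_kernel L N x) (- C))"
    proof (rule M.integrable_const_bound[of _ 1])
      show "(\<lambda>x. measure (shift_kernel L N x) (- C)) \<in> borel_measurable M"
        by (rule measurable_compose[OF m measurable_measure_subprob_algebra[OF b(1)]])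
    qed (simp add: prob_space.prob_le_1[OF p])
    show "integrable M (\<lambda>x. indicator (- K) x + measure N (- J))"
      using b by (auto simp: borel_prob_sets[OF M(1)] M.emeasure_eq_measure)
  qed
  also have "\<dots> = measure M (- K) + measure N (- J)"
    using b by (subst Bochner_Integration.integral_add)
      (auto simp: borel_prob_sets[OF M(1)] M.emeasure_eq_measure borel_prob_univ[OF M(1)]
        M.prob_space[unfolded borel_prob_univ[OF M(1)]])
  also have "\<dots> < e" using K J by simp
  finally show "\<exists>K. compact K \<and> measure (bind M (shift_kernel L N)) (- K) < e" using C by blast
qed

text \<open>
  Averaging the kernel over \<open>M\<close> gives the law of \<open>L X + Y\<close> for independent \<open>X\<close> and \<open>Y\<close>, so the variances add. Together with
  uniqueness this yields both the invariance of the limit measure and the Chapman--Kolmogorov equation.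
\<close>

lemma gaussian_form_bind:
  assumes M: "gaussian_form M a" and N: "gaussian_form N b"
  shows "gaussian_form (bind M (shift_kernel L N)) (\<lambda>u. a (u o\<^sub>L L) + b u)"
proof -
  have bM: "borel_prob M" and bN: "borel_prob N" and i: "(\<integral>x. cos (blinfun_apply u x) \<partial>M) = exp (- a u / 2)" "(\<integral>x. sin (blinfun_apply u x) \<partial>M) = 0" for u
    using M N by (auto simp: gaussian_form_def)
  have m: "shift_kernel L N \<in> measurable M (subprob_algebra borel)"
    by (rule borel_prob_measurable[OF bM measurable_shift_kernel[OF bN]])
  have bB: "borel_prob (bind M (shift_kernel L N))" by (rule borel_prob_bind[OF bM bN])
  have int: "(\<integral>z. g z \<partial>bind M (shift_kernel L N)) = (\<integral>x. \<integral>z. g z \<partial>shift_kernel L N x \<partial>M)" if "g \<in> trig" for g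
    by (rule integral_bind_kernel[OF m _ prob_space_imp_subprob_space[OF borel_prob_space[OF bM]] trig_integrable[OF bB that]])
      (simp add: borel_prob_univ[OF bM])
  show ?thesis
    unfolding gaussian_form_def
    using bB compactly_concentrated_bind[OF bM _ bN, of L] M N
    by (auto simp: gaussian_form_def int[OF trig_cos] int[OF trig_sin] integral_trig_shift_kernel[OF N] i
        exp_add[symmetric] simp del: blinfun_apply_blinfun_compose)
qed

section \<open>Gaussian measures with given covariance\<close>

text \<open>
  All four values are expressed through the second moment, which also covers the point mass.
\<close>

lemma
  assumes "centered_normal_law N"
  shows normal_law_cos: "(\<integral>x. cos x \<partial>N) = exp (- (\<integral>x. x\<^sup>2 \<partial>N) / 2)"
    and normal_law_sin: "(\<integral>x. sin x \<partial>N) = 0"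
    and normal_law_exp_integrable: "integrable N (\<lambda>x. exp x)"
    and normal_law_exp: "(\<integral>x. exp x \<partial>N) = exp ((\<integral>x. x\<^sup>2 \<partial>N) / 2)"
proof -
  have "(\<integral>x. cos x \<partial>N) = exp (- (\<integral>x. x\<^sup>2 \<partial>N) / 2) \<and> (\<integral>x. sin x \<partial>N) = 0 \<and>
    integrable N (\<lambda>x. exp x) \<and> (\<integral>x. exp x \<partial>N) = exp ((\<integral>x. x\<^sup>2 \<partial>N) / 2)"
    using assms unfolding centered_normal_law_def
  proof
    assume N: "N = return borel 0"
    have "integrable (return borel 0) (\<lambda>x. exp x :: real)"
      by (rule integrableI_bounded) (auto simp: nn_integral_return)
    then show ?thesis unfolding N by (simp add: integral_return)
  next
    assume "\<exists>\<sigma>>0. N = density lborel (\<lambda>x. ennreal (normal_density 0 \<sigma> x))"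
    then obtain \<sigma> where \<sigma>: "0 < \<sigma>" and N: "N = density lborel (\<lambda>x. ennreal (normal_density 0 \<sigma> x))"
      by blast
    have int: "(\<integral>x. g x \<partial>N) = (\<integral>x. normal_density 0 \<sigma> x * g x \<partial>lborel)"
      if "g \<in> borel_measurable borel" for g :: "real \<Rightarrow> real"
      unfolding N using that by (subst integral_density) auto
    have var: "(\<integral>x. x\<^sup>2 \<partial>N) = \<sigma>\<^sup>2"
      using integral_normal_moment_even[OF \<sigma>, of 0 1] \<sigma> by (subst int) (simp_all add: power2_eq_square mult.commute mult.left_commute)
    have scale: "(\<integral>x. g x \<partial>N) = (\<integral>x. g (\<sigma> * x) \<partial>std_normal_distribution)"
      if g: "g \<in> borel_measurable borel" for g :: "real \<Rightarrow> real"
    proof -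
      have nd: "\<sigma> * normal_density 0 \<sigma> (\<sigma> * x) = std_normal_density x" for x
        using \<sigma> by (simp add: normal_density_def real_sqrt_mult field_simps power_mult_distrib)
      have "(\<integral>x. g x \<partial>N) = \<bar>\<sigma>\<bar> *\<^sub>R (\<integral>x. normal_density 0 \<sigma> (0 + \<sigma> * x) * g (0 + \<sigma> * x) \<partial>lborel)"
        unfolding int[OF g] using \<sigma> by (intro lborel_integral_real_affine) simp
      also have "\<dots> = (\<integral>x. \<sigma> * (normal_density 0 \<sigma> (\<sigma> * x) * g (\<sigma> * x)) \<partial>lborel)"
        using \<sigma> by simp
      also have "\<dots> = (\<integral>x. std_normal_density x * g (\<sigma> * x) \<partial>lborel)"
        by (simp only: mult.assoc[symmetric] nd)
      also have "\<dots> = (\<integral>x. g (\<sigma> * x) \<partial>std_normal_distribution)"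
        using g by (subst integral_density) auto
      finally show ?thesis .
    qed
    interpret std: real_distribution std_normal_distribution by (rule real_dist_normal_dist)
    have iint: "integrable std_normal_distribution (\<lambda>x. iexp (\<sigma> * x))"
      by (rule std.integrable_const_bound[of _ 1]) auto
    have ch: "(\<integral>x. iexp (\<sigma> * x) \<partial>std_normal_distribution) = of_real (exp (- \<sigma>\<^sup>2 / 2))"
      using fun_cong[OF char_std_normal_distribution, of \<sigma>] by (simp add: char_def)
    have "(\<integral>x. cos x \<partial>N) = (\<integral>x. Re (iexp (\<sigma> * x)) \<partial>std_normal_distribution)"
      by (subst scale) (auto simp: Re_exp)
    also have "\<dots> = exp (- \<sigma>\<^sup>2 / 2)" by (subst integral_Re[OF iint]) (simp only: ch, simp)
    finally have c: "(\<integral>x. cos x \<partial>N) = exp (- \<sigma>\<^sup>2 / 2)" .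
    have "(\<integral>x. sin x \<partial>N) = (\<integral>x. Im (iexp (\<sigma> * x)) \<partial>std_normal_distribution)"
      by (subst scale) (auto simp: Im_exp)
    also have "\<dots> = 0" by (subst integral_Im[OF iint]) (simp only: ch, simp)
    finally have s: "(\<integral>x. sin x \<partial>N) = 0" .
    \<comment> \<open>Completing the square turns the exponential weight into a translation of the density.\<close>
    have nd_exp: "normal_density 0 \<sigma> x * exp x = exp (\<sigma>\<^sup>2 / 2) * normal_density (\<sigma>\<^sup>2) \<sigma> x" for x
    proof -
      have "- x\<^sup>2 / (2 * \<sigma>\<^sup>2) + x = \<sigma>\<^sup>2 / 2 + - (x - \<sigma>\<^sup>2)\<^sup>2 / (2 * \<sigma>\<^sup>2)"
        using \<sigma> by (simp add: field_simps power2_eq_square)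
      then have "exp (- x\<^sup>2 / (2 * \<sigma>\<^sup>2)) * exp x = exp (\<sigma>\<^sup>2 / 2) * exp (- (x - \<sigma>\<^sup>2)\<^sup>2 / (2 * \<sigma>\<^sup>2))"
        by (simp only: exp_add[symmetric])
      then show ?thesis by (simp add: normal_density_def)
    qed
    have ei: "integrable N (\<lambda>x. exp x)"
      unfolding N using \<sigma> by (subst integrable_density) (auto simp: nd_exp)
    have e: "(\<integral>x. exp x \<partial>N) = exp (\<sigma>\<^sup>2 / 2)"
      using \<sigma> by (subst int) (simp_all add: nd_exp)
    show ?thesis unfolding var using c s ei e by simp
  qed
  then show "(\<integral>x. cos x \<partial>N) = exp (- (\<integral>x. x\<^sup>2 \<partial>N) / 2)" "(\<integral>x. sin x \<partial>N) = 0"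
    "integrable N (\<lambda>x. exp x)" "(\<integral>x. exp x \<partial>N) = exp ((\<integral>x. x\<^sup>2 \<partial>N) / 2)" by auto
qed

lemma borel_prob_centered_gaussian: "centered_gaussian_radon M \<Longrightarrow> borel_prob M"
  by (simp add: centered_gaussian_radon_def borel_prob_def)

lemma compactly_concentrated_centered_gaussian:
  assumes M: "centered_gaussian_radon M"
  shows "compactly_concentrated M"
  unfolding compactly_concentrated_def
proof (intro allI impI)
  fix e :: real assume e: "0 < e"
  have bM: "borel_prob M" by (rule borel_prob_centered_gaussian[OF M])
  interpret prob_space M by (rule borel_prob_space[OF bM])
  have sp: "space M = UNIV" by (rule borel_prob_univ[OF bM])
  have one: "(SUP K\<in>{K. compact K \<and> K \<subseteq> UNIV}. emeasure M K) = 1"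
    using M emeasure_space_1 unfolding centered_gaussian_radon_def sp by (metis UNIV_I sets.top sp)
  have "ennreal (1 - e) < 1" using e by (simp add: ennreal_less_one_iff)
  then obtain K where K: "compact K" "ennreal (1 - e) < emeasure M K"
    unfolding one[symmetric] less_SUP_iff by auto
  then have "1 - e < measure M K" by (simp add: emeasure_eq_measure ennreal_less_iff) (metis ennreal_less_iff emeasure_eq_measure ennreal_neg leI measure_nonneg not_less_iff_gr_or_eq order_less_le_trans zero_less_measure_iff)
  moreover have "measure M (- K) = 1 - measure M K"
    using K prob_compl[of K] by (simp add: borel_prob_sets[OF bM] sp Compl_eq_Diff_UNIV compact_imp_closed)
  ultimately show "\<exists>K. compact K \<and> measure M (- K) < e" using K by (intro exI[of _ K]) simp
qed

lemma blinfun_measurable: "blinfun_apply u \<in> borel_measurable borel"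
  by (intro borel_measurable_continuous_onI continuous_intros)

lemma
  assumes M: "centered_gaussian_radon M" and R: "has_covariance M R"
  shows gaussian_form_covariance: "gaussian_form M (\<lambda>u. u (R u))"
    and gaussian_exp_integrable: "integrable M (\<lambda>x. exp (blinfun_apply u x))"
    and gaussian_exp: "(\<integral>x. exp (blinfun_apply u x) \<partial>M) = exp (u (R u) / 2)"
proof -
  have bM: "borel_prob M" by (rule borel_prob_centered_gaussian[OF M])
  have um: "blinfun_apply u \<in> measurable M borel" for u :: "'a \<Rightarrow>\<^sub>L real"
    by (rule borel_prob_measurable[OF bM blinfun_measurable])
  have law: "centered_normal_law (distr M borel (blinfun_apply u))" for u :: "'a \<Rightarrow>\<^sub>L real"
    using M by (simp add: centered_gaussian_radon_def)
  have var: "(\<integral>x. x\<^sup>2 \<partial>distr M borel (blinfun_apply u)) = u (R u)" for u :: "'a \<Rightarrow>\<^sub>L real"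
    using R by (subst integral_distr[OF um]) (auto simp: has_covariance_def power2_eq_square)
  have "(\<integral>x. cos (u x) \<partial>M) = exp (- u (R u) / 2)" "(\<integral>x. sin (u x) \<partial>M) = 0" for u :: "'a \<Rightarrow>\<^sub>L real"
    using normal_law_cos[OF law[of u]] normal_law_sin[OF law[of u]] by (simp_all add: integral_distr[OF um] var)
  then show "gaussian_form M (\<lambda>u. u (R u))"
    unfolding gaussian_form_def using bM compactly_concentrated_centered_gaussian[OF M] by auto
  show "integrable M (\<lambda>x. exp (blinfun_apply u x))"
    using normal_law_exp_integrable[OF law[of u]] by (simp add: integrable_distr_eq[OF um])
  show "(\<integral>x. exp (blinfun_apply u x) \<partial>M) = exp (u (R u) / 2)"
    using normal_law_exp[OF law[of u]] by (simp add: integral_distr[OF um] var)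
qed

section \<open>The variances of the stochastic convolution\<close>

lemma inner_hilbert_adjoint: "inner (hilbert_adjoint B u) g = u (B g)"
proof -
  obtain h where h: "\<And>g. inner h g = (u o\<^sub>L B) g" using riesz_representation by blast
  have "\<forall>g. inner (hilbert_adjoint B u) g = u (B g)"
    unfolding hilbert_adjoint_def
  proof (rule theI)
    show "\<forall>g. inner h g = u (B g)" using h by simp
    fix k assume "\<forall>g. inner k g = u (B g)"
    then have "inner (k - h) (k - h) = 0" using h by (simp add: inner_diff_left)
    then show "k = h" by simp
  qed
  then show ?thesis by blast
qed

lemma norm_hilbert_adjoint_le: "norm (hilbert_adjoint B u) \<le> norm u * norm B"
proof (cases "hilbert_adjoint B u = 0")
  case False
  let ?h = "hilbert_adjoint B u"
  have "(norm ?h)\<^sup>2 = u (B ?h)" by (simp add: power2_norm_eq_inner inner_hilbert_adjoint)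
  also have "\<dots> \<le> norm u * (norm B * norm ?h)"
    using norm_blinfun[of u "B ?h"] mult_left_mono[OF norm_blinfun[of B ?h] norm_ge_zero[of u]] by simp
  finally show ?thesis using False by (simp add: power2_eq_square mult.assoc[symmetric])
qed simp

lemma norm_le_iff_inner:
  fixes h :: "'h::real_inner"
  assumes "0 \<le> c"
  shows "norm h \<le> c \<longleftrightarrow> (\<forall>g. norm g \<le> 1 \<longrightarrow> inner h g \<le> c)"
proof
  assume h: "norm h \<le> c"
  show "\<forall>g. norm g \<le> 1 \<longrightarrow> inner h g \<le> c"
  proof (intro allI impI)
    fix g :: 'h assume g: "norm g \<le> 1"
    have "inner h g \<le> norm h * norm g" by (rule norm_cauchy_schwarz)
    also have "\<dots> \<le> c * 1" using h g assms by (intro mult_mono) auto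
    finally show "inner h g \<le> c" by simp
  qed
next
  assume *: "\<forall>g. norm g \<le> 1 \<longrightarrow> inner h g \<le> c"
  show "norm h \<le> c"
  proof (cases "h = 0")
    case False
    have "inner h (h /\<^sub>R norm h) \<le> c" using False by (intro *[rule_format]) simp
    moreover have "inner h (h /\<^sub>R norm h) = norm h"
      using False by (simp add: power2_norm_eq_inner[symmetric] power2_eq_square)
    ultimately show ?thesis by simp
  qed (use assms in simp)
qed

text \<open>
  The integrand \<open>\<parallel>B\<^sup>* S(s)\<^sup>* u\<parallel>\<^sup>2\<close> of the variance \<open>\<langle>Q\<^sub>t u, u\<rangle>\<close>.
\<close>

definition energy :: "(real \<Rightarrow> ('e::banach \<Rightarrow>\<^sub>L 'e)) \<Rightarrow> ('h::{real_inner,complete_space} \<Rightarrow>\<^sub>L 'e) \<Rightarrow>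
    ('e \<Rightarrow>\<^sub>L real) \<Rightarrow> real \<Rightarrow> real" where
  "energy S B u s = (norm (hilbert_adjoint B (u o\<^sub>L S s)))\<^sup>2"

definition variance_form :: "(real \<Rightarrow> ('e::banach \<Rightarrow>\<^sub>L 'e)) \<Rightarrow> ('h::{real_inner,complete_space} \<Rightarrow>\<^sub>L 'e) \<Rightarrow>
    real \<Rightarrow> ('e \<Rightarrow>\<^sub>L real) \<Rightarrow> real" where
  "variance_form S B t u = (LINT s:{0..t}|lborel. energy S B u s)"

lemma energy_eq: "energy S B u s = u (S s (B (hilbert_adjoint B (u o\<^sub>L S s))))"
  unfolding energy_def power2_norm_eq_inner inner_hilbert_adjoint by simp

lemma energy_shift:
  assumes "c0_semigroup S" "0 \<le> s" "0 \<le> t"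
  shows "energy S B u (t + s) = energy S B (u o\<^sub>L S t) s"
proof -
  have "u o\<^sub>L S (t + s) = (u o\<^sub>L S t) o\<^sub>L S s"
    using assms by (intro blinfun_eqI) (simp add: C0_add)
  then show ?thesis by (simp add: energy_def)
qed

text \<open>
  The norm of \<open>B\<^sup>* S(s)\<^sup>* u\<close> is a supremum over the unit ball of functions that are continuous in \<open>s\<close>, so its sublevel
  sets on the half line are closed. The indicator removes the negative times, at which \<open>S\<close> is arbitrary.
\<close>

lemma energy_measurable:
  assumes S: "c0_semigroup S"
  shows "(\<lambda>s. indicator {0..} s * energy S B u s) \<in> borel_measurable borel"
proof -
  let ?n = "\<lambda>s. indicator {0..} s * norm (hilbert_adjoint B (u o\<^sub>L S s))"
  have "?n \<in> borel_measurable borel"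
  proof (rule borel_measurableI_le)
    fix c :: real
    show "{s \<in> space borel. ?n s \<le> c} \<in> sets borel"
    proof (cases "0 \<le> c")
      case True
      have iff: "norm (hilbert_adjoint B v) \<le> c \<longleftrightarrow> (\<forall>g. norm g \<le> 1 \<longrightarrow> v (B g) \<le> c)" for v
        by (simp only: norm_le_iff_inner[OF True] inner_hilbert_adjoint)
      have "0 \<in> {g::'b. norm g \<le> 1}" by simp
      then have "{s \<in> space borel. ?n s \<le> c} = {..<0} \<union> (\<Inter>g\<in>{g. norm g \<le> 1}. {s \<in> {0..}. u (S s (B g)) \<le> c})"
        using True by (auto simp: indicator_def iff not_le split: if_splits)
      moreover have "closed (\<Inter>g\<in>{g. norm g \<le> 1}. {s \<in> {0..}. u (S s (B g)) \<le> c})"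
        by (intro closed_INT ballI continuous_on_closed_Collect_le continuous_on_const
            bounded_linear.continuous_on[OF blinfun.bounded_linear_right C0_continuous_on[OF S]]) auto
      ultimately show ?thesis by (auto intro: borel_closed)
    next
      case False
      have "{s \<in> space borel. ?n s \<le> c} = {}"
      proof -
        have "0 \<le> ?n s" for s by simp
        then show ?thesis using False by (auto simp: not_le intro: less_le_trans)
      qed
      then show ?thesis by simp
    qed
  qed
  then have "(\<lambda>s. (?n s)\<^sup>2) \<in> borel_measurable borel" by measurable
  moreover have "(\<lambda>s. (?n s)\<^sup>2) = (\<lambda>s. indicator {0..} s * energy S B u s)"
    by (auto simp: energy_def indicator_def fun_eq_iff)
  ultimately show ?thesis by simp
qed

lemma energy_bound:
  assumes S: "c0_semigroup S"
  obtains C where "0 \<le> C" "\<And>s. 0 \<le> s \<Longrightarrow> s \<le> T \<Longrightarrow> energy S B u s \<le> C"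
proof -
  obtain M where M: "0 \<le> M" "\<And>t. 0 \<le> t \<Longrightarrow> t \<le> T \<Longrightarrow> norm (S t) \<le> M"
    using C0_locally_bounded[OF S] by blast
  show thesis
  proof (rule that[of "((norm u * M) * norm B)\<^sup>2"])
    fix s assume s: "0 \<le> s" "s \<le> T"
    have "norm (hilbert_adjoint B (u o\<^sub>L S s)) \<le> norm (u o\<^sub>L S s) * norm B" by (rule norm_hilbert_adjoint_le)
    also have "\<dots> \<le> (norm u * norm (S s)) * norm B" by (intro mult_right_mono norm_blinfun_compose) simp
    also have "\<dots> \<le> (norm u * M) * norm B" using M(2)[OF s] by (intro mult_right_mono mult_left_mono) auto
    finally show "energy S B u s \<le> ((norm u * M) * norm B)\<^sup>2" unfolding energy_def by (intro power_mono) auto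
  qed simp
qed

lemma energy_nonneg: "0 \<le> energy S B u s"
  by (simp add: energy_def)

lemma energy_integrable:
  assumes S: "c0_semigroup S" and a: "0 \<le> a"
  shows "set_integrable lborel {a..b} (energy S B u)"
proof -
  obtain C where C: "0 \<le> C" "\<And>s. 0 \<le> s \<Longrightarrow> s \<le> b \<Longrightarrow> energy S B u s \<le> C"
    using energy_bound[OF S] by blast
  have "integrable lborel (\<lambda>s. indicator {a..b} s *\<^sub>R (indicator {0..} s * energy S B u s))"
  proof (rule integrableI_bounded_set_indicator[of _ _ _ C])
    show "AE x in lborel. x \<in> {a..b} \<longrightarrow> norm (indicator {0..} x * energy S B u x) \<le> C"
      using C a by (auto simp: indicator_def energy_nonneg)
    show "emeasure lborel {a..b} < \<infinity>" by (simp add: emeasure_lborel_Icc_eq)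
  qed (use energy_measurable[OF S] in auto)
  then show ?thesis
    unfolding set_integrable_def
    by (rule back_subst[of "integrable lborel"]) (use a in \<open>auto simp: indicator_def fun_eq_iff\<close>)
qed

lemma variance_form_nonneg: "0 \<le> variance_form S B t u"
  unfolding variance_form_def set_lebesgue_integral_def by (intro Bochner_Integration.integral_nonneg) (simp add: energy_nonneg)

lemma variance_form_tendsto_0:
  assumes S: "c0_semigroup S"
  shows "((\<lambda>t. variance_form S B t u) \<longlongrightarrow> 0) (at_right 0)"
proof -
  obtain C where C: "0 \<le> C" "\<And>s. 0 \<le> s \<Longrightarrow> s \<le> 1 \<Longrightarrow> energy S B u s \<le> C"
    using energy_bound[OF S] by blast
  have le: "variance_form S B t u \<le> t * C" if t: "0 < t" "t < 1" for t
  proof -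
    have "variance_form S B t u \<le> (LINT s:{0..t}|lborel. C)"
      unfolding variance_form_def
      by (intro set_integral_mono energy_integrable[OF S]) (use t C in \<open>auto simp: set_integrable_def\<close>)
    then show ?thesis using t by (simp add: set_lebesgue_integral_def mult.commute)
  qed
  show ?thesis
  proof (rule tendsto_sandwich[of "\<lambda>_. 0" _ _ "\<lambda>t. t * C"])
    show "\<forall>\<^sub>F t in at_right 0. variance_form S B t u \<le> t * C"
      using le by (auto simp: eventually_at_right_field intro!: exI[of _ 1])
    show "((\<lambda>t. t * C) \<longlongrightarrow> 0) (at_right 0)" by (auto intro!: tendsto_eq_intros)
  qed (auto simp: variance_form_nonneg)
qed

text \<open>
  This is \<open>Q\<^sub>t\<^sub>+\<^sub>s = Q\<^sub>t + S(t) Q\<^sub>s S(t)\<^sup>*\<close>; the integrals must be known to converge, since a divergent one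
  would have the default value zero.
\<close>

lemma variance_form_add:
  assumes S: "c0_semigroup S" and s: "0 \<le> s" and t: "0 \<le> t"
  shows "variance_form S B (t + s) u = variance_form S B t u + variance_form S B s (u o\<^sub>L S t)"
proof -
  have shift: "(LINT r:{t..t + s}|lborel. energy S B u r) = variance_form S B s (u o\<^sub>L S t)"
  proof -
    have "(LINT r:{t..t + s}|lborel. energy S B u r) =
        \<bar>1\<bar> *\<^sub>R (\<integral>r. indicator {t..t + s} (t + 1 * r) *\<^sub>R energy S B u (t + 1 * r) \<partial>lborel)"
      unfolding set_lebesgue_integral_def by (rule lborel_integral_real_affine) simp
    also have "\<dots> = (\<integral>r. indicator {0..s} r *\<^sub>R energy S B (u o\<^sub>L S t) r \<partial>lborel)"
      using s t by (simp, intro Bochner_Integration.integral_cong) (auto simp: indicator_def energy_shift[OF S])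
    finally show ?thesis by (simp add: variance_form_def set_lebesgue_integral_def)
  qed
  have i1: "integrable lborel (\<lambda>r. indicator {0..t} r *\<^sub>R energy S B u r)"
    and i2: "integrable lborel (\<lambda>r. indicator {t..t + s} r *\<^sub>R energy S B u r)"
    and i3: "integrable lborel (\<lambda>r. indicator {0..t + s} r *\<^sub>R energy S B u r)"
    using energy_integrable[OF S order_refl] energy_integrable[OF S t] by (simp_all add: set_integrable_def)
  have "variance_form S B (t + s) u = (\<integral>r. indicator {0..t} r *\<^sub>R energy S B u r + indicator {t..t + s} r *\<^sub>R energy S B u r \<partial>lborel)"
    unfolding variance_form_def set_lebesgue_integral_def
  proof (rule integral_cong_AE)
    show "AE r in lborel. indicator {0..t + s} r *\<^sub>R energy S B u r =
        indicator {0..t} r *\<^sub>R energy S B u r + indicator {t..t + s} r *\<^sub>R energy S B u r"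
      using AE_lborel_singleton[of t] by eventually_elim (use s t in \<open>auto simp: indicator_def\<close>)
  qed (use i1 i2 i3 in \<open>auto intro: borel_measurable_integrable\<close>)
  also have "\<dots> = variance_form S B t u + (LINT r:{t..t + s}|lborel. energy S B u r)"
    unfolding variance_form_def set_lebesgue_integral_def by (rule Bochner_Integration.integral_add[OF i1 i2])
  finally show ?thesis by (simp add: shift)
qed

lemma variance_form_zero:
  assumes S: "c0_semigroup S"
  shows "variance_form S B 0 u = 0"
proof -
  have "u o\<^sub>L S 0 = u" by (rule blinfun_eqI) (simp add: C0_zero[OF S])
  then show ?thesis using variance_form_add[OF S, of 0 0 B u] by simp
qed

section \<open>Contractions of complex integrable functions\<close>

lemma L1_norm_nonneg: "0 \<le> L1_norm M f"
  unfolding L1_norm_def by (intro Bochner_Integration.integral_nonneg) simp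

lemma L1_norm_triangle:
  assumes "integrable M f" "integrable M g" "integrable M h"
    and "AE x in M. norm (f x) \<le> norm (g x) + norm (h x)"
  shows "L1_norm M f \<le> L1_norm M g + L1_norm M h"
proof -
  have "L1_norm M f \<le> (\<integral>x. norm (g x) + norm (h x) \<partial>M)"
    unfolding L1_norm_def using assms by (intro integral_mono_AE) auto
  also have "\<dots> = L1_norm M g + L1_norm M h"
    unfolding L1_norm_def using assms by (intro Bochner_Integration.integral_add) auto
  finally show ?thesis .
qed

lemma L1_norm_cong_AE:
  assumes "integrable M f" "integrable M g" "AE x in M. f x = g x"
  shows "L1_norm M f = L1_norm M g"
  unfolding L1_norm_def using assms by (intro integral_cong_AE) auto

lemma L1_norm_scale: "L1_norm M (\<lambda>x. c * f x) = norm c * L1_norm M f"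
  by (simp add: L1_norm_def norm_mult)

lemma L1_linear_integrable: "L1_linear M T \<Longrightarrow> integrable M f \<Longrightarrow> integrable M (T f)"
  by (simp add: L1_linear_def)

lemma L1_linear_diff:
  assumes T: "L1_linear M T" and f: "integrable M f" and g: "integrable M g"
  shows "AE x in M. T (\<lambda>y. f y - g y) x = T f x - T g x"
proof -
  have "AE x in M. T (\<lambda>y. (f y - g y) + g y) x = T (\<lambda>y. f y - g y) x + T g x"
    using T f g unfolding L1_linear_def by (elim conjE allE[of _ "\<lambda>y. f y - g y"] allE[of _ g]) simp
  then show ?thesis by eventually_elim simp
qed

lemma L1_contraction_dist:
  assumes T: "L1_linear M T" "\<And>f. integrable M f \<Longrightarrow> L1_norm M (T f) \<le> L1_norm M f"
    and f: "integrable M f" and g: "integrable M g"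
  shows "L1_norm M (\<lambda>x. T f x - T g x) \<le> L1_norm M (\<lambda>x. f x - g x)"
proof -
  have "L1_norm M (\<lambda>x. T f x - T g x) = L1_norm M (T (\<lambda>y. f y - g y))"
    using L1_linear_diff[OF T(1) f g] f g
    by (intro L1_norm_cong_AE) (auto intro!: L1_linear_integrable[OF T(1)] Bochner_Integration.integrable_diff)
  also have "\<dots> \<le> L1_norm M (\<lambda>x. f x - g x)" using f g by (intro T(2)) auto
  finally show ?thesis .
qed

lemma L1_truncation:
  fixes f :: "'a \<Rightarrow> complex"
  assumes f: "integrable M f"
  shows "(\<lambda>n. L1_norm M (\<lambda>x. f x - (if norm (f x) \<le> real n then f x else 0))) \<longlonglongrightarrow> 0"
proof -
  have [measurable]: "f \<in> borel_measurable M" using f by simp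
  have "(\<lambda>n. \<integral>x. norm (f x - (if norm (f x) \<le> real n then f x else 0)) \<partial>M) \<longlonglongrightarrow> (\<integral>x. 0 \<partial>M)"
  proof (rule integral_dominated_convergence[where w = "\<lambda>x. norm (f x)"])
    show "AE x in M. (\<lambda>n. norm (f x - (if norm (f x) \<le> real n then f x else 0))) \<longlonglongrightarrow> 0"
    proof (rule AE_I2)
      fix x
      obtain k :: nat where k: "norm (f x) \<le> real k" using real_arch_simple by blast
      have "norm (f x) \<le> real n" if "k \<le> n" for n using k that by simp
      then show "(\<lambda>n. norm (f x - (if norm (f x) \<le> real n then f x else 0))) \<longlonglongrightarrow> 0"
        by (intro tendsto_eventually) (auto simp: eventually_sequentially)
    qed
  qed (use f in auto)
  then show ?thesis by (simp add: L1_norm_def)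
qed

lemma L1_norm_zero_AE:
  assumes "integrable M f" "L1_norm M f \<le> 0"
  shows "AE x in M. f x = 0"
proof -
  have "(\<integral>x. norm (f x) \<partial>M) = 0" using assms(2) L1_norm_nonneg[of M f] unfolding L1_norm_def by (rule antisym)
  then have "AE x in M. norm (f x) = 0"
    using assms(1) by (subst (asm) integral_nonneg_eq_0_iff_AE) auto
  then show ?thesis by simp
qed

text \<open>
  Both semigroups agree with the Mehler formula on truncations of \<open>f\<close>, and contractivity passes the equality to the
  limit.
\<close>

lemma ou_extension_unique:
  assumes M: "borel_prob M" and T: "ou_extension S \<mu> M T" and T': "ou_extension S \<mu> M T'"
    and t: "0 \<le> t" and f: "integrable M f"
  shows "AE x in M. T t f x = T' t f x"
proof -
  have fm: "f \<in> borel_measurable borel"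
    using borel_measurable_integrable[OF f] measurable_cong_sets[OF borel_prob_sets[OF M] refl] by blast
  note [measurable] = fm
  define g where "g = (\<lambda>n x. if norm (f x) \<le> real n then f x else 0)"
  have gm: "g n \<in> borel_measurable borel" for n unfolding g_def by measurable
  have gb: "norm (g n x) \<le> real n" for n x by (simp add: g_def)
  have gi: "integrable M (g n)" for n by (rule borel_prob_integrable[OF M gm gb])
  have bd: "bounded (range (g n))" for n using gb unfolding bounded_iff by blast
  have lin: "L1_linear M (T t)" "L1_linear M (T' t)"
    and con: "\<And>f. integrable M f \<Longrightarrow> L1_norm M (T t f) \<le> L1_norm M f"
      "\<And>f. integrable M f \<Longrightarrow> L1_norm M (T' t f) \<le> L1_norm M f"
    using T T' t by (auto simp: ou_extension_def L1_contraction_semigroup_def)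
  have eq: "AE x in M. T t (g n) x = T' t (g n) x" for n
  proof -
    have "AE x in M. T t (g n) x = ou_operator S \<mu> t (g n) x" "AE x in M. T' t (g n) x = ou_operator S \<mu> t (g n) x"
      using T T' t gm[of n] bd[of n] by (auto simp: ou_extension_def)
    then show ?thesis by eventually_elim simp
  qed
  note int = L1_linear_integrable[OF lin(1) f] L1_linear_integrable[OF lin(2) f]
    L1_linear_integrable[OF lin(1) gi] L1_linear_integrable[OF lin(2) gi]
  have le: "L1_norm M (\<lambda>x. T t f x - T' t f x) \<le> 2 * L1_norm M (\<lambda>x. f x - g n x)" for n
  proof -
    have "L1_norm M (\<lambda>x. T t f x - T' t f x) \<le>
        L1_norm M (\<lambda>x. T t f x - T t (g n) x) + L1_norm M (\<lambda>x. T' t f x - T' t (g n) x)"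
    proof (rule L1_norm_triangle)
      show "AE x in M. norm (T t f x - T' t f x) \<le> norm (T t f x - T t (g n) x) + norm (T' t f x - T' t (g n) x)"
        using eq[of n]
      proof eventually_elim
        case (elim x)
        then show ?case using norm_triangle_ineq4[of "T t f x - T t (g n) x" "T' t f x - T' t (g n) x"] by simp
      qed
    qed (intro Bochner_Integration.integrable_diff int)+
    also have "\<dots> \<le> L1_norm M (\<lambda>x. f x - g n x) + L1_norm M (\<lambda>x. f x - g n x)"
      by (intro add_mono L1_contraction_dist lin con f gi)
    finally show ?thesis by simp
  qed
  have "(\<lambda>n. 2 * L1_norm M (\<lambda>x. f x - g n x)) \<longlonglongrightarrow> 2 * 0"
    using L1_truncation[OF f] unfolding g_def by (intro tendsto_intros)
  then have "L1_norm M (\<lambda>x. T t f x - T' t f x) \<le> 2 * 0"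
    by (rule tendsto_lowerbound) (use le in auto)
  then have "AE x in M. T t f x - T' t f x = 0"
    by (intro L1_norm_zero_AE Bochner_Integration.integrable_diff int) simp
  then show ?thesis by simp
qed

section \<open>The Mehler semigroup\<close>

text \<open>
  The data of the Mehler formula, with \<open>q t u\<close> and \<open>q_inf u\<close> for \<open>\<langle>Q\<^sub>t u, u\<rangle>\<close> and \<open>\<langle>Q\<^sub>\<infinity> u, u\<rangle>\<close>.
  The family \<open>\<nu>\<close> includes the time \<open>0\<close>, where it is the point mass at zero.
\<close>

locale gaussian_mehler =
  fixes S :: "real \<Rightarrow> ('e::banach \<Rightarrow>\<^sub>L 'e)" and \<nu> :: "real \<Rightarrow> 'e measure" and q :: "real \<Rightarrow> ('e \<Rightarrow>\<^sub>L real) \<Rightarrow> real"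
    and M :: "'e measure" and q_inf :: "('e \<Rightarrow>\<^sub>L real) \<Rightarrow> real"
  assumes S: "c0_semigroup S"
    and \<nu>: "\<And>t. 0 \<le> t \<Longrightarrow> gaussian_form (\<nu> t) (q t)"
    and q_0: "\<And>u. q 0 u = 0"
    and q_add: "\<And>s t u. 0 \<le> s \<Longrightarrow> 0 \<le> t \<Longrightarrow> q (t + s) u = q t u + q s (u o\<^sub>L S t)"
    and q_tendsto_0: "\<And>u. ((\<lambda>t. q t u) \<longlongrightarrow> 0) (at_right 0)"
    and q_nonneg: "\<And>t u. 0 \<le> q t u"
    and M: "gaussian_form M q_inf"
    and M_regular: "\<forall>A\<in>sets borel. emeasure M A = (SUP K\<in>{K. compact K \<and> K \<subseteq> A}. emeasure M K)"
    and q_inf: "\<And>t u. 0 \<le> t \<Longrightarrow> q_inf u = q t u + q_inf (u o\<^sub>L S t)"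
begin

definition \<kappa> :: "real \<Rightarrow> 'e \<Rightarrow> 'e measure" where
  "\<kappa> t = shift_kernel (S t) (\<nu> t)"

lemma prob_M: "borel_prob M" and cc_M: "compactly_concentrated M"
  using M by (auto simp: gaussian_form_def)

lemma prob_\<nu>: "0 \<le> t \<Longrightarrow> borel_prob (\<nu> t)"
  using \<nu> by (auto simp: gaussian_form_def)

lemma space_M: "space M \<noteq> {}"
  by (simp add: borel_prob_univ[OF prob_M])

lemma \<kappa>_measurable: "0 \<le> t \<Longrightarrow> \<kappa> t \<in> measurable borel (subprob_algebra borel)"
  unfolding \<kappa>_def by (intro measurable_shift_kernel prob_\<nu>)

lemma \<kappa>_measurable_M: "0 \<le> t \<Longrightarrow> \<kappa> t \<in> measurable M (subprob_algebra borel)"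
  by (rule borel_prob_measurable[OF prob_M \<kappa>_measurable])

lemma bind_invariant:
  assumes t: "0 \<le> t"
  shows "bind M (\<kappa> t) = M"
proof (rule gaussian_form_unique[OF _ M])
  have "(\<lambda>u. q_inf (u o\<^sub>L S t) + q t u) = q_inf"
    by (rule ext, subst q_inf[OF t]) (rule add.commute)
  then show "gaussian_form (bind M (\<kappa> t)) q_inf"
    using gaussian_form_bind[OF M \<nu>[OF t], of "S t"] by (simp only: \<kappa>_def)
qed

lemma \<nu>_0: "\<nu> 0 = return borel 0"
  using \<nu>[of 0] gaussian_form_return by (intro gaussian_form_unique[of _ "q 0"]) (simp_all add: q_0[abs_def] q_0 gaussian_form_def)

text \<open>
  After translating by \<open>S(t + s) x\<close> the claim is the convolution identity for the measures \<open>\<nu>\<close>.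
\<close>

lemma chapman_kolmogorov:
  assumes s: "0 \<le> s" and t: "0 \<le> t"
  shows "bind (\<kappa> s x) (\<kappa> t) = \<kappa> (s + t) x"
proof -
  have st: "0 \<le> t + s" using s t by simp
  have conv: "bind (\<nu> s) (\<kappa> t) = \<nu> (t + s)"
  proof (rule gaussian_form_unique[OF _ \<nu>[OF st]])
    have "(\<lambda>u. q s (u o\<^sub>L S t) + q t u) = q (t + s)"
      by (rule ext, subst q_add[OF s t]) (rule add.commute)
    then show "gaussian_form (bind (\<nu> s) (\<kappa> t)) (q (t + s))"
      using gaussian_form_bind[OF \<nu>[OF s] \<nu>[OF t], of "S t"] by (simp only: \<kappa>_def)
  qed
  have ne: "space (\<nu> s) \<noteq> {}" by (simp add: borel_prob_univ[OF prob_\<nu>[OF s]])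
  have m: "\<kappa> t \<in> measurable (\<nu> s) (subprob_algebra borel)"
    by (rule borel_prob_measurable[OF prob_\<nu>[OF s] \<kappa>_measurable[OF t]])
  have k: "\<kappa> t (S s x + y) = distr (\<kappa> t y) borel (\<lambda>z. S (t + s) x + z)" for y
  proof -
    have "distr (\<kappa> t y) borel (\<lambda>z. S (t + s) x + z) = distr (\<nu> t) borel ((\<lambda>z. S (t + s) x + z) \<circ> (\<lambda>z. S t y + z))"
      unfolding \<kappa>_def shift_kernel_def
      by (rule distr_distr[OF borel_measurable_shift borel_prob_measurable[OF prob_\<nu>[OF t] borel_measurable_shift]])
    also have "(\<lambda>z. S (t + s) x + z) \<circ> (\<lambda>z. S t y + z) = (\<lambda>z. S t (S s x + y) + z)"
      using s t by (simp add: fun_eq_iff C0_add[OF S] blinfun.add_right)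
    finally show ?thesis by (simp add: \<kappa>_def shift_kernel_def)
  qed
  have "bind (\<kappa> s x) (\<kappa> t) = bind (\<nu> s) (\<lambda>y. \<kappa> t (S s x + y))"
    unfolding \<kappa>_def[of s] shift_kernel_def
    by (rule bind_distr[OF borel_prob_measurable[OF prob_\<nu>[OF s] borel_measurable_shift] \<kappa>_measurable[OF t] ne])
  also have "\<dots> = distr (bind (\<nu> s) (\<kappa> t)) borel (\<lambda>z. S (t + s) x + z)"
    unfolding k by (rule distr_bind[OF m ne borel_measurable_shift, symmetric])
  also have "\<dots> = \<kappa> (s + t) x"
    unfolding conv by (simp add: \<kappa>_def shift_kernel_def add.commute)
  finally show ?thesis .
qed

lemma integrable_borel: "integrable M f \<Longrightarrow> f \<in> borel_measurable borel"
  using borel_measurable_integrable[of M f] measurable_cong_sets[OF borel_prob_sets[OF prob_M] refl] by blast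

lemma ou_operator_kernel:
  assumes t: "0 \<le> t" and f: "f \<in> borel_measurable borel"
  shows "ou_operator S \<nu> t f = (\<lambda>x. \<integral>y. f y \<partial>\<kappa> t x)"
proof
  fix x
  have "(\<integral>y. f y \<partial>\<kappa> t x) = (\<integral>y. f (S t x + y) \<partial>\<nu> t)"
    unfolding \<kappa>_def by (rule integral_shift_kernel[OF prob_\<nu>[OF t] f])
  moreover have "(\<integral>y. f (S 0 x + y) \<partial>\<nu> 0) = f x"
    using measurable_compose[OF borel_measurable_shift f, of x]
    by (simp add: \<nu>_0 C0_zero[OF S] integral_return)
  ultimately show "ou_operator S \<nu> t f x = (\<integral>y. f y \<partial>\<kappa> t x)" by (simp add: ou_operator_def)
qed

lemma ou_operator_L1:
  assumes t: "0 \<le> t" and f: "integrable M f"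
  shows "ou_operator S \<nu> t f = (\<lambda>x. \<integral>y. f y \<partial>\<kappa> t x)"
  by (rule ou_operator_kernel[OF t integrable_borel[OF f]])

lemma AE_integrable_\<kappa>:
  "0 \<le> t \<Longrightarrow> integrable M f \<Longrightarrow> AE x in M. integrable (\<kappa> t x) f"
  for f :: "'e \<Rightarrow> complex"
  using AE_integrable_bind[OF \<kappa>_measurable_M space_M, of t f] by (simp add: bind_invariant)

lemma ou_operator_integrable:
  assumes "0 \<le> t" "integrable M f"
  shows "integrable M (ou_operator S \<nu> t f)"
  using integrable_integral_kernel[OF \<kappa>_measurable_M space_M, of t f] assms
  by (simp add: bind_invariant ou_operator_L1)

lemma ou_operator_add:
  assumes t: "0 \<le> t" and f: "integrable M f" and g: "integrable M g"
  shows "AE x in M. ou_operator S \<nu> t (\<lambda>y. f y + g y) x = ou_operator S \<nu> t f x + ou_operator S \<nu> t g x"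
proof -
  have fg: "integrable M (\<lambda>y. f y + g y)" using f g by simp
  show ?thesis
    unfolding ou_operator_L1[OF t f] ou_operator_L1[OF t g] ou_operator_L1[OF t fg]
    using AE_integrable_\<kappa>[OF t f] AE_integrable_\<kappa>[OF t g] by eventually_elim simp
qed

lemma ou_operator_scale: "ou_operator S \<nu> t (\<lambda>y. c * f y) x = c * ou_operator S \<nu> t f x"
  by (simp add: ou_operator_def)

lemma ou_operator_linear: "0 \<le> t \<Longrightarrow> L1_linear M (ou_operator S \<nu> t)"
  unfolding L1_linear_def
  by (auto intro: ou_operator_integrable ou_operator_add simp: ou_operator_scale)

lemma ou_operator_contraction:
  assumes t: "0 \<le> t" and f: "integrable M f"
  shows "L1_norm M (ou_operator S \<nu> t f) \<le> L1_norm M f"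
proof -
  have fb: "integrable (bind M (\<kappa> t)) f" "integrable (bind M (\<kappa> t)) (\<lambda>x. norm (f x))"
    using f t by (simp_all add: bind_invariant)
  have "L1_norm M (ou_operator S \<nu> t f) = (\<integral>x. norm (\<integral>y. f y \<partial>\<kappa> t x) \<partial>M)"
    by (simp add: L1_norm_def ou_operator_L1[OF t f])
  also have "\<dots> \<le> (\<integral>x. \<integral>y. norm (f y) \<partial>\<kappa> t x \<partial>M)"
    using integrable_integral_kernel[OF \<kappa>_measurable_M[OF t] space_M fb(1)]
      integrable_integral_norm_kernel[OF \<kappa>_measurable_M[OF t] space_M fb(1)]
    by (intro integral_mono integrable_norm integral_norm_bound)
  also have "\<dots> = (\<integral>y. norm (f y) \<partial>bind M (\<kappa> t))"
    by (rule integral_bind_kernel[OF \<kappa>_measurable_M[OF t] space_M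
          prob_space_imp_subprob_space[OF borel_prob_space[OF prob_M]] fb(2), symmetric])
  also have "\<dots> = L1_norm M f" using t by (simp add: bind_invariant L1_norm_def)
  finally show ?thesis .
qed

lemma ou_operator_semigroup:
  assumes s: "0 \<le> s" and t: "0 \<le> t" and f: "integrable M f"
  shows "AE x in M. ou_operator S \<nu> (s + t) f x = ou_operator S \<nu> s (ou_operator S \<nu> t f) x"
proof -
  have st: "0 \<le> s + t" using s t by simp
  have "AE x in M. (\<integral>y. f y \<partial>\<kappa> (s + t) x) = (\<integral>y. \<integral>z. f z \<partial>\<kappa> t y \<partial>\<kappa> s x)"
    using AE_integrable_\<kappa>[OF st f]
  proof eventually_elim
    case (elim x)
    have p: "borel_prob (\<kappa> s x)" unfolding \<kappa>_def by (intro borel_prob_shift_kernel prob_\<nu> s)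
    have "integrable (bind (\<kappa> s x) (\<kappa> t)) f" using elim by (simp add: chapman_kolmogorov[OF s t])
    then have "(\<integral>y. f y \<partial>bind (\<kappa> s x) (\<kappa> t)) = (\<integral>y. \<integral>z. f z \<partial>\<kappa> t y \<partial>\<kappa> s x)"
      by (rule integral_bind_kernel[OF borel_prob_measurable[OF p \<kappa>_measurable[OF t]] _
            prob_space_imp_subprob_space[OF borel_prob_space[OF p]], rotated])
        (simp add: borel_prob_univ[OF p])
    then show ?case by (simp add: chapman_kolmogorov[OF s t])
  qed
  then show ?thesis
    using ou_operator_L1[OF s ou_operator_integrable[OF t f]] ou_operator_L1[OF t f] ou_operator_L1[OF st f] by simp
qed

definition strongly_continuous_on :: "('e \<Rightarrow> complex) \<Rightarrow> bool" where
  "strongly_continuous_on f \<longleftrightarrow>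
     ((\<lambda>t. L1_norm M (\<lambda>x. ou_operator S \<nu> t f x - f x)) \<longlongrightarrow> 0) (at_right 0)"

lemma strongly_continuous_onI:
  assumes "\<And>t. 0 < t \<Longrightarrow> L1_norm M (\<lambda>x. ou_operator S \<nu> t f x - f x) \<le> h t" "(h \<longlongrightarrow> 0) (at_right 0)"
  shows "strongly_continuous_on f"
  unfolding strongly_continuous_on_def
  by (rule tendsto_sandwich[of "\<lambda>_. 0" _ _ h])
    (use assms in \<open>auto simp: L1_norm_nonneg eventually_at_right_field intro: exI[of _ 1]\<close>)

lemma strongly_continuous_on_add:
  assumes f: "integrable M f" "strongly_continuous_on f" and g: "integrable M g" "strongly_continuous_on g"
  shows "strongly_continuous_on (\<lambda>x. f x + g x)"
proof (rule strongly_continuous_onI)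
  let ?T = "ou_operator S \<nu>"
  show "((\<lambda>t. L1_norm M (\<lambda>x. ?T t f x - f x) + L1_norm M (\<lambda>x. ?T t g x - g x)) \<longlongrightarrow> 0) (at_right 0)"
    using tendsto_add[OF f(2)[unfolded strongly_continuous_on_def] g(2)[unfolded strongly_continuous_on_def]] by simp
  fix t :: real assume "0 < t"
  then have t: "0 \<le> t" by simp
  show "L1_norm M (\<lambda>x. ?T t (\<lambda>x. f x + g x) x - (f x + g x)) \<le>
      L1_norm M (\<lambda>x. ?T t f x - f x) + L1_norm M (\<lambda>x. ?T t g x - g x)"
  proof (rule L1_norm_triangle)
    show "AE x in M. norm (?T t (\<lambda>x. f x + g x) x - (f x + g x)) \<le> norm (?T t f x - f x) + norm (?T t g x - g x)"
      using ou_operator_add[OF t f(1) g(1)]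
    proof eventually_elim
      case (elim x)
      then show ?case using norm_triangle_ineq[of "?T t f x - f x" "?T t g x - g x"] by (simp add: algebra_simps)
    qed
  qed (intro Bochner_Integration.integrable_diff Bochner_Integration.integrable_add ou_operator_integrable t f g)+
qed

lemma strongly_continuous_on_scale:
  assumes "strongly_continuous_on f"
  shows "strongly_continuous_on (\<lambda>x. c * f x)"
proof -
  have "L1_norm M (\<lambda>x. ou_operator S \<nu> t (\<lambda>x. c * f x) x - c * f x) =
      norm c * L1_norm M (\<lambda>x. ou_operator S \<nu> t f x - f x)" for t
    by (simp add: ou_operator_scale right_diff_distrib[symmetric] L1_norm_scale)
  then show ?thesis
    using tendsto_mult_left[OF assms[unfolded strongly_continuous_on_def], of "norm c"]
    by (simp add: strongly_continuous_on_def)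
qed

text \<open>
  The functions on which the semigroup is continuous form a closed set, by contractivity.
\<close>

lemma strongly_continuous_on_limit:
  assumes f: "integrable M f"
    and appr: "\<And>e. 0 < e \<Longrightarrow> \<exists>g. integrable M g \<and> strongly_continuous_on g \<and> L1_norm M (\<lambda>x. f x - g x) < e"
  shows "strongly_continuous_on f"
  unfolding strongly_continuous_on_def
proof (rule tendstoI)
  let ?T = "ou_operator S \<nu>"
  fix e :: real assume "0 < e"
  then have e: "0 < e / 3" by simp
  obtain g where g: "integrable M g" "strongly_continuous_on g" "L1_norm M (\<lambda>x. f x - g x) < e / 3"
    using appr[OF e] by blast
  have "\<forall>\<^sub>F t in at_right 0. dist (L1_norm M (\<lambda>x. ?T t g x - g x)) 0 < e / 3"
    using g(2) e unfolding strongly_continuous_on_def by (rule tendstoD)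
  moreover have "\<forall>\<^sub>F t in at_right (0::real). 0 < t" by (simp add: eventually_at_right_less)
  ultimately show "\<forall>\<^sub>F t in at_right 0. dist (L1_norm M (\<lambda>x. ?T t f x - f x)) 0 < e"
  proof eventually_elim
    case (elim t)
    then have t: "0 \<le> t" by simp
    note int = ou_operator_integrable[OF t f] ou_operator_integrable[OF t g(1)] f g(1)
    have "L1_norm M (\<lambda>x. ?T t f x - f x) \<le> L1_norm M (\<lambda>x. ?T t f x - ?T t g x) + L1_norm M (\<lambda>x. ?T t g x - f x)"
      by (rule L1_norm_triangle) (use int norm_triangle_ineq[of "?T t f x - ?T t g x" "?T t g x - f x" for x] in
          \<open>auto intro!: AE_I2\<close>)
    also have "L1_norm M (\<lambda>x. ?T t g x - f x) \<le> L1_norm M (\<lambda>x. ?T t g x - g x) + L1_norm M (\<lambda>x. f x - g x)"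
      by (rule L1_norm_triangle) (use int norm_triangle_ineq4[of "?T t g x - g x" "f x - g x" for x] in
          \<open>auto intro!: AE_I2\<close>)
    also have "L1_norm M (\<lambda>x. ?T t f x - ?T t g x) \<le> L1_norm M (\<lambda>x. f x - g x)"
      by (rule L1_contraction_dist[OF ou_operator_linear[OF t] ou_operator_contraction[OF t] f g(1)])
    finally show ?case using elim g(3) L1_norm_nonneg[of M] by (simp add: dist_real_def)
  qed
qed

end

section \<open>Strong continuity\<close>

lemma tendsto_integral_abs_at_right:
  fixes h :: "real \<Rightarrow> 'a::topological_space \<Rightarrow> real"
  assumes M: "borel_prob M" and m: "\<And>t. h t \<in> borel_measurable borel"
    and bd: "\<And>t x. 0 < t \<Longrightarrow> \<bar>h t x\<bar> \<le> C"
    and lim: "\<And>x. ((\<lambda>t. h t x) \<longlongrightarrow> 0) (at_right 0)"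
  shows "((\<lambda>t. \<integral>x. \<bar>h t x\<bar> \<partial>M) \<longlongrightarrow> 0) (at_right 0)"
  unfolding tendsto_at_iff_sequentially
proof (intro allI impI)
  fix X :: "nat \<Rightarrow> real" assume X: "\<forall>i. X i \<in> {0<..} - {0}" "X \<longlonglongrightarrow> 0"
  interpret prob_space M by (rule borel_prob_space[OF M])
  have mM: "h t \<in> borel_measurable M" for t by (rule borel_prob_measurable[OF M m])
  have "(\<lambda>i. \<integral>x. \<bar>h (X i) x\<bar> \<partial>M) \<longlonglongrightarrow> (\<integral>x. 0 \<partial>M)"
  proof (rule integral_dominated_convergence[where w = "\<lambda>_. C"])
    show "AE x in M. (\<lambda>i. \<bar>h (X i) x\<bar>) \<longlonglongrightarrow> 0"
    proof (intro AE_I2 tendsto_rabs_zero)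
      fix x show "(\<lambda>i. h (X i) x) \<longlonglongrightarrow> 0"
        using lim[of x] X unfolding tendsto_at_iff_sequentially by (auto simp: o_def)
    qed
    show "AE x in M. norm \<bar>h (X i) x\<bar> \<le> C" for i using X bd by (auto intro!: AE_I2)
  qed (use mM in auto)
  then show "((\<lambda>t. \<integral>x. \<bar>h t x\<bar> \<partial>M) \<circ> X) \<longlonglongrightarrow> 0" by (simp add: o_def)
qed

context gaussian_mehler begin

text \<open>
  On a character the semigroup acts by a damping factor that tends to one and by moving the argument along an orbit, so
  dominated convergence applies.
\<close>

lemma strongly_continuous_on_real:
  assumes g: "g \<in> borel_measurable borel"
    and eq: "\<And>t x. 0 \<le> t \<Longrightarrow> (\<integral>y. g y \<partial>\<kappa> t x) = exp (- q t u / 2) * k (u (S t x))"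
    and k: "continuous_on UNIV k" "\<And>y. \<bar>k y\<bar> \<le> 1" and gk: "\<And>x. g x = k (blinfun_apply u x)"
  shows "strongly_continuous_on (\<lambda>x. of_real (g x))"
proof -
  define h where "h = (\<lambda>t x. exp (- q t u / 2) * k (u (S t x)) - g x)"
  have "L1_norm M (\<lambda>x. ou_operator S \<nu> t (\<lambda>x. of_real (g x)) x - of_real (g x)) \<le> (\<integral>x. \<bar>h t x\<bar> \<partial>M)"
    if t: "0 < t" for t
  proof -
    have "ou_operator S \<nu> t (\<lambda>x. of_real (g x)) x = complex_of_real (exp (- q t u / 2) * k (u (S t x)))" for x
      using t g by (subst ou_operator_kernel) (auto simp: eq)
    then have "norm (ou_operator S \<nu> t (\<lambda>x. of_real (g x)) x - complex_of_real (g x)) = \<bar>h t x\<bar>" for x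
      unfolding h_def by (simp only: of_real_diff[symmetric] norm_of_real)
    then show ?thesis by (simp add: L1_norm_def)
  qed
  moreover have "((\<lambda>t. \<integral>x. \<bar>h t x\<bar> \<partial>M) \<longlongrightarrow> 0) (at_right 0)"
  proof (rule tendsto_integral_abs_at_right[OF prob_M])
    have "continuous_on UNIV (\<lambda>x. k (u (S t x)))" for t
      by (intro continuous_on_compose2[OF k(1)] continuous_intros) auto
    then have [measurable]: "(\<lambda>x. k (u (S t x))) \<in> borel_measurable borel" for t
      by (rule borel_measurable_continuous_onI)
    show "h t \<in> borel_measurable borel" for t unfolding h_def using g by measurable
    show "\<bar>h t x\<bar> \<le> 2" for t x
    proof -
      have "exp (- q t u / 2) * \<bar>k (u (S t x))\<bar> \<le> 1 * 1"
        by (intro mult_mono) (auto simp: q_nonneg k)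
      moreover have "\<bar>h t x\<bar> \<le> exp (- q t u / 2) * \<bar>k (u (S t x))\<bar> + \<bar>g x\<bar>"
        unfolding h_def by (rule order_trans[OF abs_triangle_ineq4]) (simp add: abs_mult)
      ultimately show ?thesis using k(2)[of "u x"] gk[of x] by simp
    qed
    fix x
    have "((\<lambda>t. u (S t x)) \<longlongrightarrow> u x) (at_right 0)" by (intro tendsto_intros C0_tendsto[OF S])
    moreover have "isCont k (u x)" using k(1) by (simp add: continuous_on_eq_continuous_at)
    ultimately have "((\<lambda>t. k (u (S t x))) \<longlongrightarrow> k (u x)) (at_right 0)" by (rule isCont_tendsto_compose[rotated])
    then have "((\<lambda>t. exp (- q t u / 2) * k (u (S t x)) - g x) \<longlongrightarrow> exp (- 0 / 2) * k (u x) - g x) (at_right 0)"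
      by (intro tendsto_intros q_tendsto_0) simp
    then show "((\<lambda>t. h t x) \<longlongrightarrow> 0) (at_right 0)" by (simp add: h_def gk)
  qed
  ultimately show ?thesis by (rule strongly_continuous_onI)
qed

lemma trig_integrable_complex: "g \<in> trig \<Longrightarrow> integrable M (\<lambda>x. complex_of_real (g x))"
  using trig_integrable[OF prob_M] by simp

lemma strongly_continuous_on_trig: "g \<in> trig \<Longrightarrow> strongly_continuous_on (\<lambda>x. of_real (g x))"
proof (induction rule: trig.induct)
  case (trig_cos u)
  show ?case
    by (rule strongly_continuous_on_real[where k = cos and u = u])
      (auto simp: \<kappa>_def integral_trig_shift_kernel[OF \<nu>] trig_measurable[OF trig.trig_cos] intro!: continuous_intros)
next
  case (trig_sin u)
  show ?case
    by (rule strongly_continuous_on_real[where k = sin and u = u])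
      (auto simp: \<kappa>_def integral_trig_shift_kernel[OF \<nu>] trig_measurable[OF trig.trig_sin] intro!: continuous_intros)
next
  case (trig_scale f c)
  then show ?case using strongly_continuous_on_scale[of "\<lambda>x. of_real (f x)" "of_real c"] by simp
next
  case (trig_add f g)
  then show ?case
    using strongly_continuous_on_add[OF trig_integrable_complex _ trig_integrable_complex, of f g] by simp
qed

text \<open>
  Trigonometric polynomials approximate indicator functions, hence all integrable functions.
\<close>

lemma strongly_continuous:
  assumes "integrable M f"
  shows "strongly_continuous_on f"
  using assms
proof induction
  case (base A c)
  have A: "A \<in> sets borel" using base by (simp add: borel_prob_sets[OF prob_M])
  have int: "integrable M (\<lambda>x. indicator A x *\<^sub>R c)" using base by simp
  show ?case
  proof (rule strongly_continuous_on_limit[OF int])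
    fix e :: real assume e: "0 < e"
    then have "0 < e / (norm c + 1)" by (simp add: add_nonneg_pos)
    then obtain g where g: "g \<in> trig" "(\<integral>x. \<bar>indicator A x - g x\<bar> \<partial>M) < e / (norm c + 1)"
      using trig_approx_set[OF prob_M M_regular cc_M A] by blast
    have "L1_norm M (\<lambda>x. indicator A x *\<^sub>R c - c * of_real (g x)) = norm c * (\<integral>x. \<bar>indicator A x - g x\<bar> \<partial>M)"
    proof -
      have "norm (indicator A x *\<^sub>R c - c * of_real (g x)) = norm c * \<bar>indicator A x - g x\<bar>" for x
      proof -
        have "indicator A x *\<^sub>R c - c * of_real (g x) = c * of_real (indicator A x - g x)"
          by (simp add: scaleR_conv_of_real algebra_simps)
        then show ?thesis by (simp only: norm_mult norm_of_real)
      qed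
      then show ?thesis by (simp add: L1_norm_def)
    qed
    also have "\<dots> \<le> norm c * (e / (norm c + 1))" using g by (intro mult_left_mono) auto
    also have "\<dots> < e"
    proof -
      have "0 < norm c + 1" by (simp add: add_nonneg_pos)
      then show ?thesis using e by (simp add: pos_divide_less_eq algebra_simps)
    qed
    finally show "\<exists>g. integrable M g \<and> strongly_continuous_on g \<and> L1_norm M (\<lambda>x. indicator A x *\<^sub>R c - g x) < e"
      using trig_integrable_complex[OF g(1)] strongly_continuous_on_trig[OF g(1)]
      by (intro exI[of _ "\<lambda>x. c * of_real (g x)"]) (auto intro: strongly_continuous_on_scale)
  qed
next
  case (add f g)
  then show ?case by (intro strongly_continuous_on_add)
next
  case (lim f s)
  show ?case
  proof (rule strongly_continuous_on_limit)
    show "integrable M f" by fact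
    fix e :: real assume e: "0 < e"
    have "(\<lambda>i. L1_norm M (\<lambda>x. f x - s i x)) \<longlonglongrightarrow> (\<integral>x. 0 \<partial>M)"
      unfolding L1_norm_def
    proof (rule integral_dominated_convergence[where w = "\<lambda>x. 3 * norm (f x)"])
      show "AE x in M. (\<lambda>i. norm (f x - s i x)) \<longlonglongrightarrow> 0"
      proof (intro AE_I2 tendsto_norm_zero)
        fix x assume "x \<in> space M"
        then show "(\<lambda>i. f x - s i x) \<longlonglongrightarrow> 0"
          using tendsto_diff[OF tendsto_const[of "f x"] lim.hyps(2)[of x]] by simp
      qed
      show "AE x in M. norm (norm (f x - s i x)) \<le> 3 * norm (f x)" for i
      proof (rule AE_I2)
        fix x assume "x \<in> space M"
        then show "norm (norm (f x - s i x)) \<le> 3 * norm (f x)"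
          using norm_triangle_ineq4[of "f x" "s i x"] lim.hyps(3)[of x i] by simp
      qed
    qed (use lim.hyps in auto)
    then have "\<forall>\<^sub>F i in sequentially. L1_norm M (\<lambda>x. f x - s i x) < e"
      using e by (intro order_tendstoD(2)[where y = "0::real"]) auto
    then obtain i where "L1_norm M (\<lambda>x. f x - s i x) < e" by (auto dest: eventually_happens)
    then show "\<exists>g. integrable M g \<and> strongly_continuous_on g \<and> L1_norm M (\<lambda>x. f x - g x) < e"
      using lim by blast
  qed
qed

text \<open>
  The Mehler formula itself, applied to integrable functions, is the extension to \<open>L\<^sup>1\<close>; for such
  functions the inner integral converges off a null set.
\<close>

lemma ou_extension_ou_operator: "ou_extension S \<nu> M (ou_operator S \<nu>)"
  unfolding ou_extension_def L1_contraction_semigroup_def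
proof (intro conjI allI impI)
  fix t :: real and f :: "'e \<Rightarrow> complex" assume "0 \<le> t" "integrable M f"
  then show "L1_norm M (ou_operator S \<nu> t f) \<le> L1_norm M f" by (rule ou_operator_contraction)
next
  fix s t :: real and f :: "'e \<Rightarrow> complex" assume "0 \<le> s" "0 \<le> t" "integrable M f"
  then show "AE x in M. ou_operator S \<nu> (s + t) f x = ou_operator S \<nu> s (ou_operator S \<nu> t f) x"
    by (rule ou_operator_semigroup)
next
  fix f :: "'e \<Rightarrow> complex" assume "integrable M f"
  then show "((\<lambda>t. L1_norm M (\<lambda>x. ou_operator S \<nu> t f x - f x)) \<longlongrightarrow> 0) (at_right 0)"
    using strongly_continuous by (simp add: strongly_continuous_on_def)
qed (simp_all add: ou_operator_linear ou_operator_def)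

end

section \<open>Cameron--Martin densities and the norm distance\<close>

locale gaussian_mehler_exp = gaussian_mehler S \<nu> q M q_inf
  for S :: "real \<Rightarrow> ('e::banach \<Rightarrow>\<^sub>L 'e)" and \<nu> q M q_inf +
  assumes exp_\<nu>: "\<And>t u. 0 \<le> t \<Longrightarrow> (\<integral>x. exp (blinfun_apply u x) \<partial>\<nu> t) = exp (q t u / 2)"
    and exp_M_integrable: "\<And>u :: 'e \<Rightarrow>\<^sub>L real. integrable M (\<lambda>x. exp (blinfun_apply u x))"
    and exp_M: "\<And>u. (\<integral>x. exp (blinfun_apply u x) \<partial>M) = exp (q_inf u / 2)"
    and parallelogram: "\<And>u v. q_inf (u + v) + q_inf (u - v) = 2 * q_inf u + 2 * q_inf v"
    and homogeneous: "\<And>c u. q_inf (c *\<^sub>R u) = c\<^sup>2 * q_inf u"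
begin

text \<open>
  When \<open>q_inf w\<close> is \<open>\<langle>Q\<^sub>\<infinity> w, w\<rangle>\<close>, this is the density of the translate of \<open>M\<close> by \<open>Q\<^sub>\<infinity> w\<close>.
\<close>

definition cm_density :: "('e \<Rightarrow>\<^sub>L real) \<Rightarrow> 'e \<Rightarrow> real" where
  "cm_density w x = exp (w x - q_inf w / 2)"

lemma cm_density_eq: "cm_density w = (\<lambda>x. exp (- q_inf w / 2) * exp (w x))"
  by (simp add: cm_density_def fun_eq_iff exp_add[symmetric])

lemma cm_density_integrable: "integrable M (cm_density w)"
  unfolding cm_density_eq by (intro integrable_mult_right exp_M_integrable)

lemma cm_density_integral: "(\<integral>x. cm_density w x \<partial>M) = 1"
  unfolding cm_density_eq by (simp only: integral_mult_right_zero exp_M) (simp add: exp_add[symmetric])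

lemma L1_norm_cm_density: "L1_norm M (\<lambda>x. of_real (cm_density w x)) = 1"
proof -
  have "norm (complex_of_real (cm_density w x)) = cm_density w x" for x by (simp add: cm_density_def)
  then show ?thesis by (simp add: L1_norm_def cm_density_integral)
qed

lemma cm_density_borel: "cm_density w \<in> borel_measurable borel"
  unfolding cm_density_def[abs_def] by (intro borel_measurable_continuous_onI continuous_intros)

text \<open>
  Integrating \<open>exp w\<close> over \<open>\<nu> t\<close> contributes \<open>q t w / 2\<close> to the exponent, and \<open>q_inf w - q t w\<close> is the variance of \<open>w \<circ> S(t)\<close>.
\<close>

lemma ou_operator_cm_density:
  assumes t: "0 \<le> t"
  shows "ou_operator S \<nu> t (\<lambda>x. of_real (cm_density w x)) x = complex_of_real (cm_density (w o\<^sub>L S t) x)"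
proof -
  have "(\<integral>y. cm_density w y \<partial>\<kappa> t x) = (\<integral>y. cm_density w (S t x + y) \<partial>\<nu> t)"
    unfolding \<kappa>_def by (rule integral_shift_kernel[OF prob_\<nu>[OF t] cm_density_borel])
  also have "\<dots> = (\<integral>y. exp (w (S t x) - q_inf w / 2) * exp (w y) \<partial>\<nu> t)"
    by (simp add: cm_density_def blinfun.add_right exp_add[symmetric] algebra_simps)
  also have "\<dots> = exp (w (S t x) - q_inf w / 2) * exp (q t w / 2)"
    by (simp only: integral_mult_right_zero exp_\<nu>[OF t])
  also have "\<dots> = cm_density (w o\<^sub>L S t) x"
    unfolding cm_density_def exp_add[symmetric] q_inf[OF t, of w] by (simp add: field_simps)
  finally show ?thesis
    using cm_density_borel by (subst ou_operator_kernel[OF t]) auto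
qed

text \<open>
  For positive functions \<open>a\<^sup>2\<close> and \<open>b\<^sup>2\<close> the pointwise bound \<open>(a - b)\<^sup>2 \<le> \<bar>a\<^sup>2 - b\<^sup>2\<bar>\<close> reduces the distance to the integral of \<open>a b\<close>. Here
  \<open>a b\<close> is again the exponential of a functional, and the parallelogram law evaluates its integral.
\<close>

lemma cm_density_distance: "2 - 2 * exp (- q_inf (u - v) / 8) \<le> (\<integral>x. \<bar>cm_density u x - cm_density v x\<bar> \<partial>M)"
proof -
  define h where "h = (\<lambda>x. exp (((1/2) *\<^sub>R (u + v)) x))"
  define c where "c = exp (- (q_inf u + q_inf v) / 4)"
  have h: "integrable M h" "(\<integral>x. h x \<partial>M) = exp (q_inf (u + v) / 8)"
    unfolding h_def using exp_M_integrable exp_M homogeneous by (simp_all add: power2_eq_square)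
  have "c * exp (q_inf (u + v) / 8) = exp (- q_inf (u - v) / 8)"
    unfolding c_def exp_add[symmetric] using parallelogram[of u v] by (intro arg_cong[of _ _ exp]) (simp add: field_simps)
  then have ch: "c * (\<integral>x. h x \<partial>M) = exp (- q_inf (u - v) / 8)" by (simp only: h)
  have le: "cm_density u x + cm_density v x - 2 * (c * h x) \<le> \<bar>cm_density u x - cm_density v x\<bar>" for x
  proof -
    define a b where "a = exp ((u x - q_inf u / 2) / 2)" and "b = exp ((v x - q_inf v / 2) / 2)"
    have pos: "0 \<le> a" "0 \<le> b" by (simp_all add: a_def b_def)
    have A: "cm_density u x = a\<^sup>2" "cm_density v x = b\<^sup>2"
      by (simp_all add: cm_density_def a_def b_def power2_eq_square exp_add[symmetric])
    have AB: "c * h x = a * b"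
      unfolding c_def h_def a_def b_def exp_add[symmetric]
      by (intro arg_cong[of _ _ exp]) (simp add: blinfun.bilinear_simps field_simps)
    have "a\<^sup>2 + b\<^sup>2 - 2 * (a * b) = \<bar>a - b\<bar> * \<bar>a - b\<bar>" by (simp add: abs_mult_self_eq power2_eq_square algebra_simps)
    also have "\<dots> \<le> \<bar>a - b\<bar> * (a + b)" using pos by (intro mult_left_mono) auto
    also have "\<dots> = \<bar>(a - b) * (a + b)\<bar>" using pos by (simp add: abs_mult)
    also have "(a - b) * (a + b) = a\<^sup>2 - b\<^sup>2" by (simp add: power2_eq_square algebra_simps)
    finally show ?thesis unfolding A AB .
  qed
  have "2 - 2 * exp (- q_inf (u - v) / 8) = (\<integral>x. cm_density u x + cm_density v x - 2 * (c * h x) \<partial>M)"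
    using cm_density_integrable h(1) by (simp add: cm_density_integral ch)
  also have "\<dots> \<le> (\<integral>x. \<bar>cm_density u x - cm_density v x\<bar> \<partial>M)"
    using cm_density_integrable h(1) le by (intro integral_mono) auto
  finally show ?thesis .
qed

text \<open>
  The density of \<open>w\<close> is a unit vector whose images under the two operators are explicit.
\<close>

lemma L1_opnorm_diff_lower:
  fixes w :: "'e \<Rightarrow>\<^sub>L real"
  assumes T: "ou_extension S \<nu> M T" and s: "0 \<le> s" and t: "0 \<le> t"
  shows "2 - 2 * exp (- q_inf ((w o\<^sub>L S s) - (w o\<^sub>L S t)) / 8) \<le> L1_opnorm M (\<lambda>f x. T s f x - T t f x)"
proof -
  let ?F = "\<lambda>w x. complex_of_real (cm_density w x)"
  have lin: "L1_linear M (T r)" and con: "\<And>f. integrable M f \<Longrightarrow> L1_norm M (T r f) \<le> L1_norm M f" if "0 \<le> r" for r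
    using T that by (auto simp: ou_extension_def L1_contraction_semigroup_def)
  have F: "integrable M (?F w)" for w using cm_density_integrable by simp
  have TF: "AE x in M. T r (?F w) x = ?F (w o\<^sub>L S r) x" if r: "0 \<le> r" for r
    using ou_extension_unique[OF prob_M T ou_extension_ou_operator r F] by (simp add: ou_operator_cm_density[OF r])
  have "L1_norm M (\<lambda>x. T s (?F w) x - T t (?F w) x) = L1_norm M (\<lambda>x. ?F (w o\<^sub>L S s) x - ?F (w o\<^sub>L S t) x)"
  proof (rule L1_norm_cong_AE)
    show "AE x in M. T s (?F w) x - T t (?F w) x = ?F (w o\<^sub>L S s) x - ?F (w o\<^sub>L S t) x"
      using TF[OF s] TF[OF t] by eventually_elim simp
  qed (intro Bochner_Integration.integrable_diff F L1_linear_integrable[OF lin[OF s] F]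
      L1_linear_integrable[OF lin[OF t] F])+
  also have "\<dots> = (\<integral>x. \<bar>cm_density (w o\<^sub>L S s) x - cm_density (w o\<^sub>L S t) x\<bar> \<partial>M)"
    unfolding L1_norm_def by (simp only: of_real_diff[symmetric] norm_of_real)
  finally have "2 - 2 * exp (- q_inf ((w o\<^sub>L S s) - (w o\<^sub>L S t)) / 8) \<le> L1_norm M (\<lambda>x. T s (?F w) x - T t (?F w) x)"
    using cm_density_distance by simp
  also have "\<dots> \<le> L1_opnorm M (\<lambda>f x. T s f x - T t f x)"
    unfolding L1_opnorm_def
  proof (rule cSUP_upper)
    show "?F w \<in> {f. integrable M f \<and> L1_norm M f \<le> 1}" using F by (simp add: L1_norm_cm_density)
    show "bdd_above ((\<lambda>f. L1_norm M (\<lambda>x. T s f x - T t f x)) ` {f. integrable M f \<and> L1_norm M f \<le> 1})"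
    proof (rule bdd_aboveI2)
      fix f assume "f \<in> {f. integrable M f \<and> L1_norm M f \<le> 1}"
      then have f: "integrable M f" "L1_norm M f \<le> 1" by auto
      note int = L1_linear_integrable[OF lin[OF s] f(1)] L1_linear_integrable[OF lin[OF t] f(1)]
      have "L1_norm M (\<lambda>x. T s f x - T t f x) \<le> L1_norm M (T s f) + L1_norm M (T t f)"
        by (rule L1_norm_triangle[OF Bochner_Integration.integrable_diff[OF int] int]) (simp add: norm_triangle_ineq4)
      then show "L1_norm M (\<lambda>x. T s f x - T t f x) \<le> 2"
        using con[OF s f(1)] con[OF t f(1)] f(2) by linarith
    qed
  qed
  finally show ?thesis .
qed

lemma L1_opnorm_diff_ge_1:
  fixes w :: "'e \<Rightarrow>\<^sub>L real"
  assumes T: "ou_extension S \<nu> M T" and s: "0 \<le> s" and t: "0 \<le> t"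
    and w: "0 < q_inf ((w o\<^sub>L S s) - (w o\<^sub>L S t))"
  shows "1 \<le> L1_opnorm M (\<lambda>f x. T s f x - T t f x)"
proof -
  let ?d = "(w o\<^sub>L S s) - (w o\<^sub>L S t)"
  \<comment> \<open>This multiple of \<open>w\<close> makes the exponential in the lower bound equal to one half.\<close>
  define c where "c = sqrt (8 * ln 2 / q_inf ?d)"
  have "c\<^sup>2 * q_inf ?d = 8 * ln 2" using w by (simp add: c_def)
  moreover have "((c *\<^sub>R w) o\<^sub>L S s) - ((c *\<^sub>R w) o\<^sub>L S t) = c *\<^sub>R ?d"
    by (rule blinfun_eqI) (simp add: blinfun.bilinear_simps algebra_simps)
  ultimately have "q_inf (((c *\<^sub>R w) o\<^sub>L S s) - ((c *\<^sub>R w) o\<^sub>L S t)) = 8 * ln 2" by (simp only: homogeneous)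
  then have "2 - 2 * exp (- ln 2) \<le> L1_opnorm M (\<lambda>f x. T s f x - T t f x)"
    using L1_opnorm_diff_lower[OF T s t, of "c *\<^sub>R w"] by simp
  moreover have "exp (- ln 2 :: real) = 1 / 2" by (simp add: exp_minus)
  ultimately show ?thesis by simp
qed

end

section \<open>Adjoint orbits and the main result\<close>

text \<open>
  Equality of \<open>S(s)\<^sup>*\<close> and \<open>S(t)\<^sup>*\<close> makes \<open>r \<mapsto> S(r)\<^sup>*\<close> periodic for \<open>r \<ge> s\<close>. The variance of \<open>w \<circ> S(s)\<close> then
  recurs along a sequence of times at which it must tend to zero, so \<open>w \<circ> S(s) = 0\<close> by nondegeneracy. No eigenvector
  survives this.
\<close>

lemma (in gaussian_mehler) adjoint_orbits_distinct:
  assumes lim: "\<And>u. ((\<lambda>t. q t u) \<longlongrightarrow> q_inf u) at_top"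
    and pos: "\<And>u. u \<noteq> 0 \<Longrightarrow> 0 < q_inf u"
    and z: "((u1, u2), cscale l (u1, u2)) \<in> complexify_op (adjoint_op (generator S))" "(u1, u2) \<noteq> 0"
    and st: "0 \<le> s" "s < t"
  shows "\<exists>w :: 'e \<Rightarrow>\<^sub>L real. w o\<^sub>L S s \<noteq> w o\<^sub>L S t"
proof (rule ccontr)
  assume "\<not> ?thesis"
  then have eq: "w o\<^sub>L S s = w o\<^sub>L S t" for w :: "'e \<Rightarrow>\<^sub>L real" by blast
  have zero: "w o\<^sub>L S s = 0" for w :: "'e \<Rightarrow>\<^sub>L real"
  proof -
    define d where "d = t - s"
    have d: "0 < d" using st by (simp add: d_def)
    \<comment> \<open>The period \<open>d\<close> can be added any number of times.\<close>
    have per: "w o\<^sub>L S (s + real n * d) = w o\<^sub>L S s" for n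
    proof (induction n)
      case (Suc n)
      have "w o\<^sub>L S (t + real n * d) = (w o\<^sub>L S t) o\<^sub>L S (real n * d)"
        using st d by (intro blinfun_eqI) (simp add: C0_add[OF S])
      also have "\<dots> = (w o\<^sub>L S s) o\<^sub>L S (real n * d)" by (simp only: eq)
      also have "\<dots> = w o\<^sub>L S (s + real n * d)"
        using st d by (intro blinfun_eqI) (simp add: C0_add[OF S])
      finally show ?case using Suc by (simp add: d_def algebra_simps)
    qed simp
    have "filterlim (\<lambda>n. s + real n * d) at_top sequentially"
      using d by (intro filterlim_tendsto_add_at_top[OF tendsto_const]
          filterlim_at_top_mult_tendsto_pos[OF tendsto_const _ filterlim_real_sequentially])
    then have "(\<lambda>n. q (s + real n * d) w) \<longlonglongrightarrow> q_inf w" by (rule filterlim_compose[OF lim])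
    moreover have "q (s + real n * d) w = q_inf w - q_inf (w o\<^sub>L S s)" for n
      using q_inf[of "s + real n * d" w] st d per[of n] by simp
    ultimately have "q_inf (w o\<^sub>L S s) = 0" by (simp add: tendsto_const_iff)
    then show ?thesis using pos[of "w o\<^sub>L S s"] by fastforce
  qed
  have "u1 x = 0 \<and> u2 x = 0" for x
  proof -
    have "(u1 o\<^sub>L S s) x = 0" "(u2 o\<^sub>L S s) x = 0" by (simp_all only: zero blinfun.zero_left)
    then have "exp (l * s) * Complex (u1 x) (u2 x) = 0"
      using C0_adjoint_eigenvector[OF S z(1) st(1), of x] by (simp add: complex_eq_iff)
    then have "Complex (u1 x) (u2 x) = 0" by simp
    then show ?thesis by (simp add: Complex_eq_0)
  qed
  then have "u1 = 0" "u2 = 0" by (auto intro: blinfun_eqI)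
  then show False using z(2) by (simp add: zero_prod_def)
qed

theorem corollary1p2:
  fixes S :: "real \<Rightarrow> ('e::banach \<Rightarrow>\<^sub>L 'e)"
    and A :: "('e \<times> 'e) set"
    and B :: "'h::{real_inner,complete_space} \<Rightarrow>\<^sub>L 'e"
    and Q :: "real \<Rightarrow> (('e \<Rightarrow>\<^sub>L real) \<Rightarrow>\<^sub>L 'e)"
    and Q_inf :: "('e \<Rightarrow>\<^sub>L real) \<Rightarrow>\<^sub>L 'e"
    and \<mu> :: "real \<Rightarrow> 'e measure"
    and \<mu>_inf :: "'e measure"
  assumes "c0_semigroup S"
    and "A = generator S"
    and "B \<noteq> 0"
    and "\<And>t (u :: 'e \<Rightarrow>\<^sub>L real) (v :: 'e \<Rightarrow>\<^sub>L real). 0 < t \<Longrightarrow>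
           blinfun_apply v (Q t u) = (LINT s:{0..t}|lborel. v (S s (B (hilbert_adjoint B (u o\<^sub>L S s)))))"
    and "\<And>t. 0 < t \<Longrightarrow> centered_gaussian_radon (\<mu> t)"
    and "\<And>t. 0 < t \<Longrightarrow> has_covariance (\<mu> t) (Q t)"
    and "\<And>(u :: 'e \<Rightarrow>\<^sub>L real) (v :: 'e \<Rightarrow>\<^sub>L real). ((\<lambda>t. blinfun_apply v (Q t u)) \<longlongrightarrow> v (Q_inf u)) at_top"
    and "centered_gaussian_radon \<mu>_inf"
    and "has_covariance \<mu>_inf Q_inf"
    and "\<And>u :: 'e \<Rightarrow>\<^sub>L real. u \<noteq> 0 \<Longrightarrow> 0 < blinfun_apply u (Q_inf u)"
    and "point_spectrum (adjoint_op A) \<noteq> {}"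
  shows "\<forall>t\<ge>0. \<not> ((\<lambda>s. L1_opnorm \<mu>_inf
           (\<lambda>f x. ou_semigroup S \<mu> \<mu>_inf s f x - ou_semigroup S \<mu> \<mu>_inf t f x)) \<longlongrightarrow> 0)
         (at t within {0..})"
proof -
  note S = assms(1)
  define \<nu> where "\<nu> = (\<lambda>t. if t = 0 then return borel 0 else \<mu> t)"
  define q_inf where "q_inf = (\<lambda>u :: 'e \<Rightarrow>\<^sub>L real. u (Q_inf u))"
  have variance_Q: "variance_form S B t u = u (Q t u)" if "0 < t" for t u
    using that by (simp add: variance_form_def energy_eq assms(4))
  have variance_lim: "((\<lambda>t. variance_form S B t u) \<longlongrightarrow> q_inf u) at_top" for u
    unfolding q_inf_def
    by (rule Lim_transform_eventually[OF assms(7)])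
      (use variance_Q in \<open>auto intro!: eventually_mono[OF eventually_gt_at_top[of 0]]\<close>)
  interpret gaussian_mehler_exp S \<nu> "variance_form S B" \<mu>_inf q_inf
  proof
    show "gaussian_form (\<nu> t) (variance_form S B t)" if t: "0 \<le> t" for t
    proof (cases "t = 0")
      case True
      have "variance_form S B 0 = (\<lambda>_. 0)" by (rule ext) (rule variance_form_zero[OF S])
      then show ?thesis using True gaussian_form_return by (simp add: \<nu>_def)
    next
      case False
      then have "variance_form S B t = (\<lambda>u. u (Q t u))" using t variance_Q by (intro ext) simp
      then show ?thesis
        using gaussian_form_covariance[OF assms(5,6), of t] False t by (simp add: \<nu>_def)
    qed
    show "(\<integral>x. exp (blinfun_apply u x) \<partial>\<nu> t) = exp (variance_form S B t u / 2)" if t: "0 \<le> t" for t u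
    proof (cases "t = 0")
      case True
      have "(\<lambda>x. exp (blinfun_apply u x)) \<in> borel_measurable borel"
        by (intro borel_measurable_continuous_onI continuous_intros)
      then show ?thesis using True by (simp add: \<nu>_def integral_return variance_form_zero[OF S])
    next
      case False
      then show ?thesis using gaussian_exp[OF assms(5,6), of t u] t variance_Q[of t u] by (simp add: \<nu>_def)
    qed
    show "q_inf u = variance_form S B t u + q_inf (u o\<^sub>L S t)" if t: "0 \<le> t" for t u
    proof (rule tendsto_unique[of at_top])
      show "((\<lambda>s. variance_form S B (t + s) u) \<longlongrightarrow> q_inf u) at_top"
        by (rule filterlim_compose[OF variance_lim filterlim_tendsto_add_at_top[OF tendsto_const filterlim_ident]])
      have "((\<lambda>s. variance_form S B t u + variance_form S B s (u o\<^sub>L S t)) \<longlongrightarrow> variance_form S B t u + q_inf (u o\<^sub>L S t)) at_top"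
        by (intro tendsto_intros variance_lim)
      then show "((\<lambda>s. variance_form S B (t + s) u) \<longlongrightarrow> variance_form S B t u + q_inf (u o\<^sub>L S t)) at_top"
        by (rule Lim_transform_eventually)
          (auto simp: variance_form_add[OF S _ t] intro!: eventually_mono[OF eventually_ge_at_top[of 0]])
    qed simp
    show "gaussian_form \<mu>_inf q_inf"
      unfolding q_inf_def by (rule gaussian_form_covariance[OF assms(8,9)])
    show "\<forall>A\<in>sets borel. emeasure \<mu>_inf A = (SUP K\<in>{K. compact K \<and> K \<subseteq> A}. emeasure \<mu>_inf K)"
      using assms(8) by (simp add: centered_gaussian_radon_def)
    show "integrable \<mu>_inf (\<lambda>x. exp (blinfun_apply u x))"
      "(\<integral>x. exp (blinfun_apply u x) \<partial>\<mu>_inf) = exp (q_inf u / 2)" for u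
      unfolding q_inf_def by (rule gaussian_exp_integrable[OF assms(8,9)] gaussian_exp[OF assms(8,9)])+
    show "q_inf (u + v) + q_inf (u - v) = 2 * q_inf u + 2 * q_inf v" for u v
      by (simp add: q_inf_def blinfun.bilinear_simps algebra_simps)
    show "q_inf (c *\<^sub>R u) = c\<^sup>2 * q_inf u" for c u
      by (simp add: q_inf_def blinfun.bilinear_simps power2_eq_square)
  qed (fact S, rule variance_form_zero[OF S], rule variance_form_add[OF S], assumption+, rule variance_form_tendsto_0[OF S], rule variance_form_nonneg)
  \<comment> \<open>The operator at time \<open>0\<close> is the identity by definition, for either family.\<close>
  have ou: "ou_operator S \<mu> = ou_operator S \<nu>"
    by (intro ext) (simp add: ou_operator_def \<nu>_def)
  define T where "T = ou_semigroup S \<mu> \<mu>_inf"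
  have T: "ou_extension S \<nu> \<mu>_inf T"
  proof -
    have "ou_extension S \<mu> \<mu>_inf = ou_extension S \<nu> \<mu>_inf"
      by (intro ext) (simp add: ou_extension_def ou)
    then show ?thesis
      unfolding T_def ou_semigroup_def using ou_extension_ou_operator by (metis someI)
  qed
  obtain l u1 u2 where z: "((u1, u2), cscale l (u1, u2)) \<in> complexify_op (adjoint_op (generator S))" "(u1, u2) \<noteq> 0"
    using assms(11) unfolding assms(2) point_spectrum_def by auto
  have pos: "0 < q_inf u" if "u \<noteq> 0" for u using assms(10)[OF that] by (simp add: q_inf_def)
  have far: "1 \<le> L1_opnorm \<mu>_inf (\<lambda>f x. T s f x - T t f x)" if t: "0 \<le> t" "t < s" for s t
  proof -
    have "\<exists>w :: 'e \<Rightarrow>\<^sub>L real. w o\<^sub>L S t \<noteq> w o\<^sub>L S s"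
      by (rule adjoint_orbits_distinct[OF variance_lim _ z t]) (rule pos)
    then obtain w :: "'e \<Rightarrow>\<^sub>L real" where "w o\<^sub>L S t \<noteq> w o\<^sub>L S s" by blast
    then have "0 < q_inf ((w o\<^sub>L S s) - (w o\<^sub>L S t))" by (intro pos) simp
    then show ?thesis using t by (intro L1_opnorm_diff_ge_1[OF T]) auto
  qed
  show ?thesis
    unfolding T_def[symmetric]
  proof (intro allI impI notI)
    fix t :: real assume t: "0 \<le> t"
    assume "((\<lambda>s. L1_opnorm \<mu>_inf (\<lambda>f x. T s f x - T t f x)) \<longlongrightarrow> 0) (at t within {0..})"
    then have "\<forall>\<^sub>F s in at t within {0..}. L1_opnorm \<mu>_inf (\<lambda>f x. T s f x - T t f x) < 1"
      by (rule order_tendstoD) simp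
    then obtain d where d: "0 < d"
      "\<And>s. 0 \<le> s \<Longrightarrow> s \<noteq> t \<Longrightarrow> dist s t < d \<Longrightarrow> L1_opnorm \<mu>_inf (\<lambda>f x. T s f x - T t f x) < 1"
      unfolding eventually_at by auto
    have "L1_opnorm \<mu>_inf (\<lambda>f x. T (t + d / 2) f x - T t f x) < 1"
      using d(1) t by (intro d(2)) (auto simp: dist_real_def)
    then show False using far[of t "t + d / 2"] t d(1) by simp
  qed
qed

end
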